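(* Let $\lambda_1,\dots,\lambda_k$ be arbitrary positive constants, and suppose that for every $n\ge 1$ there is a decision function $\delta_n^B=\delta_n^B(x_1,\dots,x_n)$ such that for all $d\in\mathscr D$ $$\sum_{i=1}^k\lambda_i\int_{\Theta_i}w(\theta,d)f_\theta^n\,d\pi_1(\theta)\geq l_n:=\sum_{i=1}^k\lambda_i\int_{\Theta_i}w(\theta,\delta_n^B)f_\theta^n\,d\pi_1(\theta)$$ $\mu^n$-almost everywhere; let $\delta^B=(\delta_1^B,\delta_2^B,\dots)$. For any $N\ge1$ define $V_N^N=l_N$ and $V_n^N=\min\{l_n,Q_n^N\}$ for $n=N-1,N-2,\dots,1$, where $Q_n^N=f^n+\int V_{n+1}^N\,d\mu(x_{n+1})$ with $f^n=\int_\Theta f_\theta^n\,d\pi_2(\theta)$. Let $V_n=\lim_{N\to\infty}V_n^N$ and $Q_n=\lim_{N\to\infty}Q_n^N$, $n=1,2,\dots$. Suppose that the problem (of minimization of $R(\psi)$ as defined in the context) is truncatable. Let $\psi$ be any stopping rule satisfying $$I_{\{l_n<Q_n\}}\leq\psi_n\leq I_{\{l_n\leq Q_n\}}$$ $\mu^n$-almost everywhere on $T_n^\psi$ for all $n=1,2,\dots$. Then for any sequential decision procedure $(\psi',\delta)$ such that $$W_i(\psi',\delta)\leq W_i(\psi,\delta^B),\quad i=1,\dots,k,\qquad( * )$$ it holds that $$N(\psi)\leq N(\psi').\qquad( ** )$$ The inequality in $( ** )$ is strict if at least one of the inequalities in $( * )$ is strict. If there are equalities in all of the inequalities in $( * )$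 and $( ** )$, then $$I_{\{l_n<Q_n\}}\leq\psi_n'\leq I_{\{l_n\leq Q_n\}}$$ $\mu^n$-almost everywhere on $T_n^{\psi'}$ for all $n=1,2,\dots$, and $$\sum_{i=1}^k\lambda_i\int_{\Theta_i}w(\theta,\delta_n)f_\theta^n\,d\pi_1(\theta)=\sum_{i=1}^k\lambda_i\int_{\Theta_i}w(\theta,\delta_n^B)f_\theta^n\,d\pi_1(\theta)$$ $\mu^n$-almost everywhere on $S_n^{\psi'}$ for all $n=1,2,\dots$.
   Context: Setting. $X_1,X_2,\dots$ is a discrete-time stochastic process whose distribution $P_\theta$ (expectation $E_\theta$) depends on an unknown parameter $\theta\in\Theta$. For every $n\ge1$, $(X_1,\dots,X_n)$ has under $P_\theta$ a density $f_\theta^n=f_\theta^n(x_1,\dots,x_n)$ with respect to the product measure $\mu^n=\mu\otimes\cdots\otimes\mu$, where $\mu$ is a $\sigma$-finite measure; $f_\theta^n(x_1,\dots,x_n)$ is measurable in $(\theta,x_1,\dots,x_n)$. A sequential decision procedure is a pair $(\psi,\delta)$, where $\psi=(\psi_1,\psi_2,\dots)$ is a (randomized) stopping rule, consisting of measurable functions $\psi_n=\psi_n(x_1,\dots,x_n)\in[0,1]$, and $\delta=(\delta_1,\delta_2,\dots)$ is a decision rule, consisting of measurable functions $\delta_n=\delta_n(x_1,\dots,x_n)\in\mathscr D$ ($\mathscr D$ is the decision space). Under an expectation sign a function $F_n$ of $(x_1,\dots,x_n)$ is evaluated at $(X_1,\dots,X_n)$. The randomized stopping time $\tau_\psi$ satisfies: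 $\tau_\psi=n$ iff $U_1>\psi_1(X_1),\dots,U_{n-1}>\psi_{n-1}(X_1,\dots,X_{n-1})$ and $U_n\le\psi_n(X_1,\dots,X_n)$, where $U_1,U_2,\dots$ are i.i.d. uniform on $[0,1]$, independent of $(X_1,X_2,\dots)$. $w(\theta,d)\ge0$ is a loss function measurable in $(\theta,d)\in\Theta\times\mathscr D$; $\pi_1,\pi_2$ are probability measures on $\Theta$ (possibly different). The average sample number is $N(\psi)=\int E_\theta\tau_\psi\,d\pi_2(\theta)$, where $E_\theta\tau_\psi=\infty$ by convention if $\sum_{n\ge1}P_\theta(\tau_\psi=n)<1$. $\Theta_1,\dots,\Theta_k$ are pairwise disjoint (measurable) subsets of $\Theta$, and $$W_i(\psi,\delta)=\sum_{n=1}^\infty\int_{\Theta_i}E_\theta(1-\psi_1)\cdots(1-\psi_{n-1})\psi_n\,w(\theta,\delta_n)\,d\pi_1(\theta),\quad i=1,\dots,k.$$ Notation: $s_n^\psi=(1-\psi_1)\cdots(1-\psi_{n-1})\psi_n$, $S_n^\psi=\{(x_1,\dots,x_n):s_n^\psi>0\}$; $t_n^\psi=(1-\psi_1)\cdots(1-\psi_{n-1})$ with $t_1^\psi\equiv1$, $T_n^\psi=\{(x_1,\dots,x_n):t_n^\psi>0\}$; $P^{\pi_2}(\tau_\psi<\infty)=\sum_{n\ge1}\int E_\theta s_n^\psi\,d\pi_2(\theta)$. $I_A$ is the indicator of $A$. Standing assumption: $\int l_1\,d\mu<\infty$, with $l_n$ as in the claim. With $l_n$ and $f^n$ as in the claim,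 the risk (unit cost per observation, loss function $w'(\theta,d)=\sum_{i=1}^k\lambda_iw(\theta,d)I_{\Theta_i}(\theta)$) is $$R(\psi)=\begin{cases}\displaystyle\sum_{n=1}^\infty\int s_n^\psi(nf^n+l_n)\,d\mu^n,&\text{if }P^{\pi_2}(\tau_\psi<\infty)=1,\\ \infty,&\text{otherwise,}\end{cases}$$ and $R_N(\psi)=\sum_{n=1}^{N-1}\int s_n^\psi(nf^n+l_n)\,d\mu^n+\int t_N^\psi(Nf^N+l_N)\,d\mu^N$. The problem of minimization of $R(\psi)$ is called truncatable if $R_N(\psi)\to R(\psi)$ as $N\to\infty$ for every stopping rule $\psi$. *)

theory Defs
  imports "HOL-Probability.Probability"
begin

text \<open>Conventions. An observation vector \<open>(x\<^sub>1, \<dots>, x\<^sub>n)\<close> is an element of the finite product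
  space over the index set \<open>{1..n}\<close>, i.e. an extensional function on \<open>{1..n}\<close>. All sequences
  (\<open>\<psi>\<close>, \<open>\<delta>\<close>, \<open>f\<close>, \<open>X\<close>, \<dots>) are indexed by natural numbers, only indices \<open>n \<ge> 1\<close> being relevant; a
  series over \<open>n \<ge> 1\<close> is written with \<open>Suc n\<close>. All integrals are of nonnegative functions and take
  values in \<open>[0, \<infinity>]\<close>.\<close>

definition obs :: "'x measure \<Rightarrow> nat \<Rightarrow> (nat \<Rightarrow> 'x) measure" where
  "obs \<mu> n = PiM {1..n} (\<lambda>_. \<mu>)"

definition Xvec :: "(nat \<Rightarrow> 'o \<Rightarrow> 'x) \<Rightarrow> nat \<Rightarrow> 'o \<Rightarrow> nat \<Rightarrow> 'x" where
  "Xvec X n \<omega> = (\<lambda>i\<in>{1..n}. X i \<omega>)"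

text \<open>\<open>Th\<close> carries the \<open>\<sigma>\<close>-algebra on the parameter space only. The probability spaces \<open>P \<theta>\<close> carry
  both the process \<open>X\<close> and the randomization variables \<open>U\<close>. Independence of the sequences
  \<open>U\<close> and \<open>X\<close> is stated through the generated \<open>\<sigma>\<close>-algebras, since \<open>indep_var\<close> needs equal value
  types.\<close>

locale sequential_model =
  fixes Th :: "'t measure"
    and \<mu> :: "'x measure"
    and P :: "'t \<Rightarrow> 'o measure"
    and X :: "nat \<Rightarrow> 'o \<Rightarrow> 'x"
    and U :: "nat \<Rightarrow> 'o \<Rightarrow> real"
    and f :: "nat \<Rightarrow> 't \<Rightarrow> (nat \<Rightarrow> 'x) \<Rightarrow> real"
  assumes sigma_finite: "sigma_finite_measure \<mu>"
    and prob: "\<And>\<theta>. \<theta> \<in> space Th \<Longrightarrow> prob_space (P \<theta>)"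
    and X_measurable: "\<And>\<theta> n. \<theta> \<in> space Th \<Longrightarrow> 1 \<le> n \<Longrightarrow> X n \<in> measurable (P \<theta>) \<mu>"
    and f_nonneg: "\<And>n \<theta> x. 1 \<le> n \<Longrightarrow> \<theta> \<in> space Th \<Longrightarrow> x \<in> space (obs \<mu> n) \<Longrightarrow> 0 \<le> f n \<theta> x"
    and f_measurable:
      "\<And>n. 1 \<le> n \<Longrightarrow> (\<lambda>(\<theta>, x). f n \<theta> x) \<in> borel_measurable (Th \<Otimes>\<^sub>M obs \<mu> n)"
    and X_density: "\<And>\<theta> n. \<theta> \<in> space Th \<Longrightarrow> 1 \<le> n \<Longrightarrow>
      distributed (P \<theta>) (obs \<mu> n) (Xvec X n) (\<lambda>x. ennreal (f n \<theta> x))"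
    and U_indep: "\<And>\<theta>. \<theta> \<in> space Th \<Longrightarrow> prob_space.indep_vars (P \<theta>) (\<lambda>_. borel) U {1..}"
    and U_uniform: "\<And>\<theta> n. \<theta> \<in> space Th \<Longrightarrow> 1 \<le> n \<Longrightarrow>
      distr (P \<theta>) borel (U n) = uniform_measure lborel {0..1}"
    and U_X_indep: "\<And>\<theta>. \<theta> \<in> space Th \<Longrightarrow>
      prob_space.indep_set (P \<theta>)
        (sets (vimage_algebra (space (P \<theta>)) (\<lambda>\<omega>. \<lambda>i\<in>{1..}. U i \<omega>) (PiM {1..} (\<lambda>_. borel))))
        (sets (vimage_algebra (space (P \<theta>)) (\<lambda>\<omega>. \<lambda>i\<in>{1..}. X i \<omega>) (PiM {1..} (\<lambda>_. \<mu>))))"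

definition stopping_rule :: "'x measure \<Rightarrow> (nat \<Rightarrow> (nat \<Rightarrow> 'x) \<Rightarrow> real) \<Rightarrow> bool" where
  "stopping_rule \<mu> \<psi> \<longleftrightarrow>
    (\<forall>n\<ge>1. \<psi> n \<in> borel_measurable (obs \<mu> n) \<and> (\<forall>x\<in>space (obs \<mu> n). 0 \<le> \<psi> n x \<and> \<psi> n x \<le> 1))"

definition decision_rule :: "'x measure \<Rightarrow> 'd measure \<Rightarrow> (nat \<Rightarrow> (nat \<Rightarrow> 'x) \<Rightarrow> 'd) \<Rightarrow> bool" where
  "decision_rule \<mu> D \<delta> \<longleftrightarrow> (\<forall>n\<ge>1. \<delta> n \<in> measurable (obs \<mu> n) D)"

definition tpsi :: "(nat \<Rightarrow> (nat \<Rightarrow> 'x) \<Rightarrow> real) \<Rightarrow> nat \<Rightarrow> (nat \<Rightarrow> 'x) \<Rightarrow> real" where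
  "tpsi \<psi> n x = (\<Prod>i\<in>{1..<n}. 1 - \<psi> i (restrict x {1..i}))"

definition spsi :: "(nat \<Rightarrow> (nat \<Rightarrow> 'x) \<Rightarrow> real) \<Rightarrow> nat \<Rightarrow> (nat \<Rightarrow> 'x) \<Rightarrow> real" where
  "spsi \<psi> n x = tpsi \<psi> n x * \<psi> n x"

definition Tset :: "'x measure \<Rightarrow> (nat \<Rightarrow> (nat \<Rightarrow> 'x) \<Rightarrow> real) \<Rightarrow> nat \<Rightarrow> (nat \<Rightarrow> 'x) set" where
  "Tset \<mu> \<psi> n = {x \<in> space (obs \<mu> n). 0 < tpsi \<psi> n x}"

definition Sset :: "'x measure \<Rightarrow> (nat \<Rightarrow> (nat \<Rightarrow> 'x) \<Rightarrow> real) \<Rightarrow> nat \<Rightarrow> (nat \<Rightarrow> 'x) set" where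
  "Sset \<mu> \<psi> n = {x \<in> space (obs \<mu> n). 0 < spsi \<psi> n x}"

definition stop_time ::
  "(nat \<Rightarrow> 'o \<Rightarrow> 'x) \<Rightarrow> (nat \<Rightarrow> 'o \<Rightarrow> real) \<Rightarrow> (nat \<Rightarrow> (nat \<Rightarrow> 'x) \<Rightarrow> real) \<Rightarrow> 'o \<Rightarrow> enat" where
  "stop_time X U \<psi> \<omega> =
    (if \<exists>n\<ge>1. U n \<omega> \<le> \<psi> n (Xvec X n \<omega>)
     then enat (LEAST n. 1 \<le> n \<and> U n \<omega> \<le> \<psi> n (Xvec X n \<omega>)) else \<infinity>)"

definition E_stop_time ::
  "'o measure \<Rightarrow> (nat \<Rightarrow> 'o \<Rightarrow> 'x) \<Rightarrow> (nat \<Rightarrow> 'o \<Rightarrow> real) \<Rightarrow> (nat \<Rightarrow> (nat \<Rightarrow> 'x) \<Rightarrow> real) \<Rightarrow> ennreal" where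
  "E_stop_time M X U \<psi> =
    (if (\<Sum>n. emeasure M {\<omega> \<in> space M. stop_time X U \<psi> \<omega> = enat (Suc n)}) < 1 then \<infinity>
     else (\<integral>\<^sup>+\<omega>. ennreal_of_enat (stop_time X U \<psi> \<omega>) \<partial>M))"

definition ASN ::
  "('t \<Rightarrow> 'o measure) \<Rightarrow> (nat \<Rightarrow> 'o \<Rightarrow> 'x) \<Rightarrow> (nat \<Rightarrow> 'o \<Rightarrow> real) \<Rightarrow> 't measure
    \<Rightarrow> (nat \<Rightarrow> (nat \<Rightarrow> 'x) \<Rightarrow> real) \<Rightarrow> ennreal" where
  "ASN P X U \<pi>\<^sub>2 \<psi> = (\<integral>\<^sup>+\<theta>. E_stop_time (P \<theta>) X U \<psi> \<partial>\<pi>\<^sub>2)"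

definition Wloss ::
  "('t \<Rightarrow> 'o measure) \<Rightarrow> (nat \<Rightarrow> 'o \<Rightarrow> 'x) \<Rightarrow> 't measure \<Rightarrow> ('t \<Rightarrow> 'd \<Rightarrow> real) \<Rightarrow> 't set
    \<Rightarrow> (nat \<Rightarrow> (nat \<Rightarrow> 'x) \<Rightarrow> real) \<Rightarrow> (nat \<Rightarrow> (nat \<Rightarrow> 'x) \<Rightarrow> 'd) \<Rightarrow> ennreal" where
  "Wloss P X \<pi>\<^sub>1 w A \<psi> \<delta> =
    (\<Sum>n. \<integral>\<^sup>+\<theta>\<in>A. (\<integral>\<^sup>+\<omega>. ennreal (spsi \<psi> (Suc n) (Xvec X (Suc n) \<omega>)
                                * w \<theta> (\<delta> (Suc n) (Xvec X (Suc n) \<omega>))) \<partial>P \<theta>) \<partial>\<pi>\<^sub>1)"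

text \<open>The weighted posterior loss of taking decision \<open>d\<close> after observing \<open>x = (x\<^sub>1, \<dots>, x\<^sub>n)\<close>;
  \<open>l\<^sub>n\<close> is its value at \<open>d = \<delta>\<^sup>B\<^sub>n(x)\<close>. The minimality of \<open>\<delta>\<^sup>B\<close> is to be used with the exceptional null
  set of observations not depending on \<open>d\<close>: with null sets depending on \<open>d\<close> it would say nothing
  about data-dependent decisions \<open>d = \<delta>\<^sub>n(x)\<close> when the decision space is uncountable.\<close>

definition wloss ::
  "nat \<Rightarrow> (nat \<Rightarrow> real) \<Rightarrow> (nat \<Rightarrow> 't set) \<Rightarrow> 't measure \<Rightarrow> ('t \<Rightarrow> 'd \<Rightarrow> real)
    \<Rightarrow> (nat \<Rightarrow> 't \<Rightarrow> (nat \<Rightarrow> 'x) \<Rightarrow> real) \<Rightarrow> nat \<Rightarrow> 'd \<Rightarrow> (nat \<Rightarrow> 'x) \<Rightarrow> ennreal" where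
  "wloss k lam Ths \<pi>\<^sub>1 w f n d x =
    (\<Sum>i=1..k. ennreal (lam i) * (\<integral>\<^sup>+\<theta>\<in>Ths i. ennreal (w \<theta> d * f n \<theta> x) \<partial>\<pi>\<^sub>1))"

definition mix_density ::
  "'t measure \<Rightarrow> (nat \<Rightarrow> 't \<Rightarrow> (nat \<Rightarrow> 'x) \<Rightarrow> real) \<Rightarrow> nat \<Rightarrow> (nat \<Rightarrow> 'x) \<Rightarrow> ennreal" where
  "mix_density \<pi>\<^sub>2 f n x = (\<integral>\<^sup>+\<theta>. ennreal (f n \<theta> x) \<partial>\<pi>\<^sub>2)"

text \<open>In the remaining definitions \<open>F\<close> stands for the sequence of mixture densities
  \<open>f\<^sup>1, f\<^sup>2, \<dots>\<close> and \<open>l\<close> for the sequence \<open>l\<^sub>1, l\<^sub>2, \<dots>\<close>. \<open>trunc_V \<mu> F l N n\<close> is \<open>V\<^sub>n\<^sup>N\<close>; only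
  \<open>n \<le> N\<close> is meaningful.\<close>

function trunc_V ::
  "'x measure \<Rightarrow> (nat \<Rightarrow> (nat \<Rightarrow> 'x) \<Rightarrow> ennreal) \<Rightarrow> (nat \<Rightarrow> (nat \<Rightarrow> 'x) \<Rightarrow> ennreal)
    \<Rightarrow> nat \<Rightarrow> nat \<Rightarrow> (nat \<Rightarrow> 'x) \<Rightarrow> ennreal" where
  "trunc_V \<mu> F l N n x =
    (if n < N
     then min (l n x) (F n x + (\<integral>\<^sup>+y. trunc_V \<mu> F l N (Suc n) (x(Suc n := y)) \<partial>\<mu>))
     else l n x)"
  by pat_completeness auto
termination
  by (relation "Wellfounded.measure (\<lambda>(\<mu>, F, l, N, n, x). N - n)") auto

declare trunc_V.simps [simp del]

definition trunc_Q ::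
  "'x measure \<Rightarrow> (nat \<Rightarrow> (nat \<Rightarrow> 'x) \<Rightarrow> ennreal) \<Rightarrow> (nat \<Rightarrow> (nat \<Rightarrow> 'x) \<Rightarrow> ennreal)
    \<Rightarrow> nat \<Rightarrow> nat \<Rightarrow> (nat \<Rightarrow> 'x) \<Rightarrow> ennreal" where
  "trunc_Q \<mu> F l N n x = F n x + (\<integral>\<^sup>+y. trunc_V \<mu> F l N (Suc n) (x(Suc n := y)) \<partial>\<mu>)"

text \<open>The limit exists everywhere, because \<open>trunc_Q \<mu> F l N n x\<close> is nonincreasing in \<open>N > n\<close>.\<close>

definition Qlim ::
  "'x measure \<Rightarrow> (nat \<Rightarrow> (nat \<Rightarrow> 'x) \<Rightarrow> ennreal) \<Rightarrow> (nat \<Rightarrow> (nat \<Rightarrow> 'x) \<Rightarrow> ennreal)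
    \<Rightarrow> nat \<Rightarrow> (nat \<Rightarrow> 'x) \<Rightarrow> ennreal" where
  "Qlim \<mu> F l n x = lim (\<lambda>N. trunc_Q \<mu> F l N n x)"

definition prob_stop ::
  "('t \<Rightarrow> 'o measure) \<Rightarrow> (nat \<Rightarrow> 'o \<Rightarrow> 'x) \<Rightarrow> 't measure
    \<Rightarrow> (nat \<Rightarrow> (nat \<Rightarrow> 'x) \<Rightarrow> real) \<Rightarrow> ennreal" where
  "prob_stop P X \<pi>\<^sub>2 \<psi> =
    (\<Sum>n. \<integral>\<^sup>+\<theta>. (\<integral>\<^sup>+\<omega>. ennreal (spsi \<psi> (Suc n) (Xvec X (Suc n) \<omega>)) \<partial>P \<theta>) \<partial>\<pi>\<^sub>2)"

definition stop_cost ::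
  "'x measure \<Rightarrow> (nat \<Rightarrow> (nat \<Rightarrow> 'x) \<Rightarrow> ennreal) \<Rightarrow> (nat \<Rightarrow> (nat \<Rightarrow> 'x) \<Rightarrow> ennreal)
    \<Rightarrow> (nat \<Rightarrow> (nat \<Rightarrow> 'x) \<Rightarrow> real) \<Rightarrow> nat \<Rightarrow> ennreal" where
  "stop_cost \<mu> F l \<psi> n = (\<integral>\<^sup>+x. ennreal (spsi \<psi> n x) * (of_nat n * F n x + l n x) \<partial>obs \<mu> n)"

definition risk ::
  "('t \<Rightarrow> 'o measure) \<Rightarrow> (nat \<Rightarrow> 'o \<Rightarrow> 'x) \<Rightarrow> 't measure \<Rightarrow> 'x measure
    \<Rightarrow> (nat \<Rightarrow> (nat \<Rightarrow> 'x) \<Rightarrow> ennreal) \<Rightarrow> (nat \<Rightarrow> (nat \<Rightarrow> 'x) \<Rightarrow> ennreal)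
    \<Rightarrow> (nat \<Rightarrow> (nat \<Rightarrow> 'x) \<Rightarrow> real) \<Rightarrow> ennreal" where
  "risk P X \<pi>\<^sub>2 \<mu> F l \<psi> =
    (if prob_stop P X \<pi>\<^sub>2 \<psi> = 1 then (\<Sum>n. stop_cost \<mu> F l \<psi> (Suc n)) else \<infinity>)"

definition trunc_risk ::
  "'x measure \<Rightarrow> (nat \<Rightarrow> (nat \<Rightarrow> 'x) \<Rightarrow> ennreal) \<Rightarrow> (nat \<Rightarrow> (nat \<Rightarrow> 'x) \<Rightarrow> ennreal)
    \<Rightarrow> nat \<Rightarrow> (nat \<Rightarrow> (nat \<Rightarrow> 'x) \<Rightarrow> real) \<Rightarrow> ennreal" where
  "trunc_risk \<mu> F l N \<psi> =
    (\<Sum>n\<in>{1..<N}. stop_cost \<mu> F l \<psi> n)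
    + (\<integral>\<^sup>+x. ennreal (tpsi \<psi> N x) * (of_nat N * F N x + l N x) \<partial>obs \<mu> N)"

definition truncatable ::
  "('t \<Rightarrow> 'o measure) \<Rightarrow> (nat \<Rightarrow> 'o \<Rightarrow> 'x) \<Rightarrow> 't measure \<Rightarrow> 'x measure
    \<Rightarrow> (nat \<Rightarrow> (nat \<Rightarrow> 'x) \<Rightarrow> ennreal) \<Rightarrow> (nat \<Rightarrow> (nat \<Rightarrow> 'x) \<Rightarrow> ennreal) \<Rightarrow> bool" where
  "truncatable P X \<pi>\<^sub>2 \<mu> F l \<longleftrightarrow>
    (\<forall>\<psi>. stopping_rule \<mu> \<psi> \<longrightarrow> (\<lambda>N. trunc_risk \<mu> F l N \<psi>) \<longlonglongrightarrow> risk P X \<pi>\<^sub>2 \<mu> F l \<psi>)"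

definition optimal_form ::
  "'x measure \<Rightarrow> (nat \<Rightarrow> (nat \<Rightarrow> 'x) \<Rightarrow> ennreal) \<Rightarrow> (nat \<Rightarrow> (nat \<Rightarrow> 'x) \<Rightarrow> ennreal)
    \<Rightarrow> (nat \<Rightarrow> (nat \<Rightarrow> 'x) \<Rightarrow> real) \<Rightarrow> bool" where
  "optimal_form \<mu> F l \<psi> \<longleftrightarrow>
    (\<forall>n\<ge>1. AE x\<in>Tset \<mu> \<psi> n in obs \<mu> n.
       indicator {x. l n x < Qlim \<mu> F l n x} x \<le> \<psi> n x \<and>
       \<psi> n x \<le> indicator {x. l n x \<le> Qlim \<mu> F l n x} x)"

end

theory Submission imports Defs
begin

text \<open>Lagrange multipliers reduce the constrained problem to the unconstrained one of minimizing
  \<open>R(\<psi>) = N(\<psi>) + \<Sum>\<^sub>i \<lambda>\<^sub>i W\<^sub>i(\<psi>, \<delta>\<^sup>B)\<close>, in which the Bayes decisions \<open>\<delta>\<^sup>B\<close> make the terminal loss \<open>l\<^sub>n\<close> smallest. Put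
  \<open>C = 1 + \<integral> V\<^sub>1 d\<mu>\<close>. Backward induction gives \<open>R\<^sub>N(\<psi>') \<ge> 1 + \<integral> V\<^sub>1\<^sup>N d\<mu> \<ge> C\<close> for every \<open>\<psi>'\<close>, hence \<open>R(\<psi>') \<ge> C\<close> by
  truncatability. For \<open>\<psi>\<close> of the optimal form, \<open>\<Sum>\<^sub>m\<^sub><\<^sub>n \<integral> s\<^sub>m (m f\<^sup>m + l\<^sub>m) + \<integral> t\<^sub>n (n f\<^sup>n + V\<^sub>n)\<close> is nonincreasing in \<open>n\<close>
  and starts at \<open>C < \<infinity>\<close>; thus \<open>\<integral> t\<^sub>n f\<^sup>n \<le> C / n\<close>, so \<open>\<psi>\<close> stops almost surely and \<open>R(\<psi>) = C\<close>. All claims about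
  \<open>N\<close> follow by cancelling the finite \<open>\<Sum>\<^sub>i \<lambda>\<^sub>i W\<^sub>i(\<psi>, \<delta>\<^sup>B)\<close>. In the case of equality every step of the lower
  bound is an equality, which forces \<open>\<psi>'\<^sub>n l\<^sub>n + (1 - \<psi>'\<^sub>n) Q\<^sub>n = min {l\<^sub>n, Q\<^sub>n}\<close> almost everywhere on \<open>T\<^sub>n\<close>.\<close>

section \<open>Extended nonnegative integrals and series\<close>

text \<open>The difference \<open>v - u\<close> has integral 0 and hence vanishes almost everywhere.
  The equality cases below all reduce to this: stopping with probability one, the risks at one
  stage, and the terminal losses.\<close>

lemma nn_integral_eq_imp_AE_eq:
  fixes u v :: "'a \<Rightarrow> ennreal"
  assumes [measurable]: "u \<in> borel_measurable M" "v \<in> borel_measurable M"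
    and le: "AE x in M. u x \<le> v x"
    and eq: "integral\<^sup>N M u = integral\<^sup>N M v" and fin: "integral\<^sup>N M v < \<infinity>"
  shows "AE x in M. u x = v x"
proof -
  have "(\<integral>\<^sup>+x. v x - u x \<partial>M) = integral\<^sup>N M v - integral\<^sup>N M u"
    by (rule nn_integral_diff) (use le eq fin in auto)
  also have "\<dots> = 0"
    using eq fin by simp
  finally have "AE x in M. v x - u x = 0"
    by (subst (asm) nn_integral_0_iff_AE) auto
  moreover have "AE x in M. v x \<noteq> \<infinity>"
    by (rule nn_integral_PInf_AE) (use fin in auto)
  ultimately show ?thesis
    using le by eventually_elim (metis diff_eq_0_iff_ennreal infinity_ennreal_def order_antisym top.not_eq_extremum)
qed

text \<open>A series is an integral with respect to counting measure, for which almost everywhere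
  means everywhere.\<close>

lemma suminf_ennreal_eq_imp_eq:
  fixes u v :: "nat \<Rightarrow> ennreal"
  assumes "\<And>n. u n \<le> v n" "(\<Sum>n. u n) = (\<Sum>n. v n)" "(\<Sum>n. v n) < \<infinity>"
  shows "u n = v n"
  using nn_integral_eq_imp_AE_eq[of u "count_space UNIV" v] assms
  by (auto simp: nn_integral_count_space_nat AE_count_space)

lemma tendsto_0_if_le_const_over_Suc:
  fixes r :: "nat \<Rightarrow> ennreal"
  assumes "\<And>n. r n \<le> ennreal (c / real (Suc n))"
  shows "r \<longlonglongrightarrow> 0"
proof (rule tendsto_sandwich)
  show "\<forall>\<^sub>F n in sequentially. 0 \<le> r n"
    by (rule always_eventually) (rule allI, rule zero_le)
  show "\<forall>\<^sub>F n in sequentially. r n \<le> ennreal (c / real (Suc n))"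
    by (rule always_eventually) (rule allI, rule assms)
  show "(\<lambda>n. 0) \<longlonglongrightarrow> (0::ennreal)"
    by (rule tendsto_const)
  have *: "(\<lambda>n. c / real (Suc n)) \<longlonglongrightarrow> 0"
    by (rule LIMSEQ_Suc[of "\<lambda>n. c / real n", OF lim_const_over_n])
  show "(\<lambda>n. ennreal (c / real (Suc n))) \<longlonglongrightarrow> 0"
    using tendsto_ennrealI[OF *] unfolding ennreal_0 .
qed
lemma suminf_eq_1_if_remainder_tendsto_0:
  fixes r p :: "nat \<Rightarrow> ennreal"
  assumes "r \<longlonglongrightarrow> 0" and one: "\<And>n. (\<Sum>m<n. p m) + r n = 1" shows "(\<Sum>n. p n) = 1"
proof -
  have "(\<lambda>n. (\<Sum>m<n. p m) + r n) \<longlonglongrightarrow> (\<Sum>n. p n) + 0"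
    using assms(1) by (intro tendsto_add summable_LIMSEQ summableI)
  then show ?thesis
    unfolding one by (simp add: LIMSEQ_const_iff)
qed

lemma sum_from_1_eq: "(\<Sum>m\<in>{1..<Suc n}. g m) = (\<Sum>m<n. g (Suc m))"
  by (induction n) (auto simp: atLeastLessThanSuc add.commute)

text \<open>Positive weight on the strictly larger of two costs raises a mixture strictly above
  their minimum if this minimum is finite; the larger cost may be infinite. It is applied with
  \<open>a\<close> the cost of stopping, \<open>b\<close> that of continuing and \<open>c\<close>
  the cost of the observations already made.\<close>

lemma mixture_eq_min_imp:
  fixes a b c :: ennreal
  assumes t: "0 < t" and p: "0 \<le> p" "p \<le> 1"
    and eq: "ennreal t * (c + min a b) = ennreal t * ennreal p * (c + a) + ennreal t * ennreal (1 - p) * (c + b)"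
    and fin: "ennreal t * (c + min a b) \<noteq> \<infinity>"
  shows "a < b \<Longrightarrow> p = 1" "b < a \<Longrightarrow> p = 0"
proof -
  have cf: "c + min a b < \<infinity>"
    using fin t by (auto simp: ennreal_mult_eq_top_iff less_top)
  have split: "ennreal t * d = ennreal t * ennreal p * d + ennreal t * ennreal (1 - p) * d" for d
    using t p by (simp flip: distrib_right distrib_left ennreal_plus)
  have less: "ennreal t * ennreal q * (c + d) < ennreal t * ennreal q * (c + e)"
    if "0 < q" "d < e" "c + d < \<infinity>" for q d e
  proof (rule ennreal_mult_strict_left_mono)
    show "c + d < c + e"
      using that by (subst ennreal_add_left_cancel_less) auto
    show "0 < ennreal t * ennreal q" "ennreal t * ennreal q < top"
      using t that by (auto simp: ennreal_zero_less_mult_iff ennreal_mult_less_top)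
  qed
  have fin': "ennreal t * ennreal q * (c + d) \<noteq> top" if "c + d < \<infinity>" for q d
    using that by (auto simp: ennreal_mult_eq_top_iff)
  show "p = 1" if "a < b"
  proof (rule ccontr)
    assume "p \<noteq> 1"
    with p that cf have "ennreal t * ennreal (1 - p) * (c + a) < ennreal t * ennreal (1 - p) * (c + b)"
      by (intro less) auto
    then have "ennreal t * ennreal p * (c + a) + ennreal t * ennreal (1 - p) * (c + a)
      < ennreal t * ennreal p * (c + a) + ennreal t * ennreal (1 - p) * (c + b)"
      using fin'[of a p] cf that by (subst ennreal_add_left_cancel_less) auto
    with eq that show False
      unfolding split[of "c + a", symmetric] by simp
  qed
  show "p = 0" if "b < a"
  proof (rule ccontr)
    assume "p \<noteq> 0"
    with p that cf have "ennreal t * ennreal p * (c + b) < ennreal t * ennreal p * (c + a)"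
      by (intro less) auto
    then have "ennreal t * ennreal (1 - p) * (c + b) + ennreal t * ennreal p * (c + b)
      < ennreal t * ennreal (1 - p) * (c + b) + ennreal t * ennreal p * (c + a)"
      using fin'[of b "1 - p"] cf that by (subst ennreal_add_left_cancel_less) auto
    moreover have "min a b = b"
      using that by simp
    ultimately have "ennreal t * (c + b) < ennreal t * (c + b)"
      using eq split[of "c + b"] by (simp only: add.commute[of "ennreal t * ennreal (1 - p) * (c + b)"])
    then show False
      by simp
  qed
qed

lemma sum_strict_mono_ennreal:
  fixes u v :: "'a \<Rightarrow> ennreal"
  assumes "finite I" "\<And>i. i \<in> I \<Longrightarrow> u i \<le> v i" "j \<in> I" "u j < v j" "sum v I < \<infinity>"
  shows "sum u I < sum v I"
proof -
  have "sum u (I - {j}) \<le> sum v (I - {j})"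
    using assms by (intro sum_mono) auto
  moreover have "sum v I = v j + sum v (I - {j})" "sum u I = u j + sum u (I - {j})"
    using assms by (auto intro: sum.remove)
  moreover have "u j + sum v (I - {j}) < v j + sum v (I - {j})"
    using assms calculation
    by (subst (1 2) add.commute, subst ennreal_add_left_cancel_less) (auto simp: less_top)
  ultimately show ?thesis
    by (metis add_left_mono order_le_less_trans)
qed

section \<open>Stopping rules\<close>

lemma tpsi_Suc: "1 \<le> n \<Longrightarrow> tpsi \<psi> (Suc n) x = tpsi \<psi> n x * (1 - \<psi> n (restrict x {1..n}))"
  by (simp add: tpsi_def atLeastLessThanSuc mult.commute)

lemma tpsi_1 [simp]: "tpsi \<psi> (Suc 0) x = 1"
  by (simp add: tpsi_def)

text \<open>Whether stage n is reached is settled by the first n - 1 observations. This allows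
  \<open>tpsi \<psi> (Suc n)\<close> to be treated as a function on \<open>obs \<mu> n\<close> and
  to be pulled out of an integral over the last coordinate.\<close>

lemma tpsi_cong: "(\<And>i. i \<in> {1..<n} \<Longrightarrow> x i = y i) \<Longrightarrow> tpsi \<psi> n x = tpsi \<psi> n y"
  unfolding tpsi_def by (intro prod.cong refl arg_cong2[where f="(-)"] arg_cong[where f="\<psi> _"]) (auto simp: restrict_def fun_eq_iff)

lemma tpsi_restrict: "n \<le> Suc m \<Longrightarrow> tpsi \<psi> n (restrict x {1..m}) = tpsi \<psi> n x"
  by (rule tpsi_cong) auto

lemma restrict_obs: "x \<in> space (obs \<mu> n) \<Longrightarrow> restrict x {1..n} = x"
  by (auto simp: obs_def space_PiM PiE_def extensional_restrict)

lemma restrict_obs_space: "x \<in> space (obs \<mu> n) \<Longrightarrow> m \<le> n \<Longrightarrow> restrict x {1..m} \<in> space (obs \<mu> m)"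
  by (auto simp: obs_def space_PiM PiE_def)

lemma measurable_restrict_obs [measurable]: "m \<le> n \<Longrightarrow> (\<lambda>x. restrict x {1..m}) \<in> measurable (obs \<mu> n) (obs \<mu> m)"
  unfolding obs_def by (rule measurable_restrict_subset) auto

lemma measurable_obs_upd [measurable]:
  "(\<lambda>(x, y). x(Suc n := y)) \<in> measurable (obs \<mu> n \<Otimes>\<^sub>M \<mu>) (obs \<mu> (Suc n))"
proof -
  have "insert (Suc n) {1..n} = {1..Suc n}"
    by auto
  then show ?thesis
    using measurable_add_dim[of "Suc n" "{1..n}" "\<lambda>_. \<mu>"] by (simp add: obs_def)
qed

lemma measurable_obs_upd2: "x \<in> space (obs \<mu> n) \<Longrightarrow> (\<lambda>y. x(Suc n := y)) \<in> measurable \<mu> (obs \<mu> (Suc n))"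
  using measurable_compose[OF measurable_Pair1' measurable_obs_upd] by simp

context
  fixes \<mu> :: "'x measure" and \<psi> :: "nat \<Rightarrow> (nat \<Rightarrow> 'x) \<Rightarrow> real"
  assumes \<psi>: "stopping_rule \<mu> \<psi>"
begin

lemma stopping_rule_measurable [measurable]: "1 \<le> n \<Longrightarrow> \<psi> n \<in> borel_measurable (obs \<mu> n)"
  using \<psi> by (auto simp: stopping_rule_def)

lemma stopping_rule_bounds: "1 \<le> n \<Longrightarrow> x \<in> space (obs \<mu> n) \<Longrightarrow> 0 \<le> \<psi> n x \<and> \<psi> n x \<le> 1"
  using \<psi> by (auto simp: stopping_rule_def)

lemma tpsi_measurable: "m \<le> Suc n \<Longrightarrow> tpsi \<psi> m \<in> borel_measurable (obs \<mu> n)"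
  unfolding tpsi_def
  by (intro borel_measurable_prod borel_measurable_diff borel_measurable_const
      measurable_compose[OF measurable_restrict_obs stopping_rule_measurable]) auto

lemma spsi_measurable: "1 \<le> n \<Longrightarrow> spsi \<psi> n \<in> borel_measurable (obs \<mu> n)"
  unfolding spsi_def[abs_def] by (intro borel_measurable_times tpsi_measurable stopping_rule_measurable) auto

lemma tpsi_nonneg: "x \<in> space (obs \<mu> n) \<Longrightarrow> m \<le> Suc n \<Longrightarrow> 0 \<le> tpsi \<psi> m x"
  unfolding tpsi_def
proof (intro prod_nonneg ballI)
  fix i assume "x \<in> space (obs \<mu> n)" "m \<le> Suc n" "i \<in> {1..<m}"
  then show "0 \<le> 1 - \<psi> i (restrict x {1..i})"
    using stopping_rule_bounds[of i, OF _ restrict_obs_space] by auto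
qed

lemma spsi_nonneg: "1 \<le> n \<Longrightarrow> x \<in> space (obs \<mu> n) \<Longrightarrow> 0 \<le> spsi \<psi> n x"
  unfolding spsi_def by (intro mult_nonneg_nonneg tpsi_nonneg) (auto dest: stopping_rule_bounds[rotated])

lemma ennreal_spsi:
  "1 \<le> n \<Longrightarrow> x \<in> space (obs \<mu> n) \<Longrightarrow> ennreal (spsi \<psi> n x) = ennreal (tpsi \<psi> n x) * ennreal (\<psi> n x)"
  unfolding spsi_def by (intro ennreal_mult tpsi_nonneg) (auto dest: stopping_rule_bounds[rotated])

lemma ennreal_tpsi_Suc:
  "1 \<le> n \<Longrightarrow> x \<in> space (obs \<mu> n) \<Longrightarrow>
    ennreal (tpsi \<psi> (Suc n) x) = ennreal (tpsi \<psi> n x) * ennreal (1 - \<psi> n x)"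
  using stopping_rule_bounds[of n x] tpsi_nonneg[of x n n]
  by (simp add: tpsi_Suc restrict_obs[simplified] ennreal_mult)

text \<open>Used as a partition of unity: a cost weighted by \<open>tpsi \<psi> n\<close> becomes a
  mixture of stopping now and going on.\<close>

lemma ennreal_spsi_add_tpsi_Suc:
  assumes "1 \<le> n" "x \<in> space (obs \<mu> n)"
  shows "ennreal (spsi \<psi> n x) + ennreal (tpsi \<psi> (Suc n) x) = ennreal (tpsi \<psi> n x)"
proof -
  have "spsi \<psi> n x + tpsi \<psi> (Suc n) x = tpsi \<psi> n x"
    using assms by (simp add: spsi_def tpsi_Suc restrict_obs[simplified] algebra_simps)
  then show ?thesis
    using assms spsi_nonneg[of n x] tpsi_nonneg[of x n "Suc n"] by (simp flip: ennreal_plus)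
qed

end

section \<open>Optimal stopping for a consistent family of densities\<close>

lemma trunc_V_le_l: "trunc_V \<mu> F l N n x \<le> l n x"
  by (subst trunc_V.simps) auto

lemma trunc_V_less: "n < N \<Longrightarrow> trunc_V \<mu> F l N n x = min (l n x) (trunc_Q \<mu> F l N n x)"
  by (subst trunc_V.simps) (auto simp: trunc_Q_def)

lemma trunc_V_self: "trunc_V \<mu> F l N N x = l N x"
  by (subst trunc_V.simps) auto

text \<open>A longer horizon adds the option of continuing at stage N, which can only lower the
  value there; monotonicity of minimum and integral carries this back to stage n. The base case
  covers every \<open>n \<ge> N\<close>, where \<open>trunc_V\<close> is \<open>l n\<close> by
  default.\<close>

lemma trunc_V_Suc_le: "trunc_V \<mu> F l (Suc N) n x \<le> trunc_V \<mu> F l N n x"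
proof (induction "N - n" arbitrary: n x)
  case 0
  then show ?case
    by (subst (2) trunc_V.simps) (auto intro: trunc_V_le_l)
next
  case (Suc d)
  then have "n < N" "\<And>x. trunc_V \<mu> F l (Suc N) (Suc n) x \<le> trunc_V \<mu> F l N (Suc n) x"
    by auto
  then show ?case
    unfolding trunc_V_less[OF \<open>n < N\<close>] trunc_V_less[OF less_SucI[OF \<open>n < N\<close>]] trunc_Q_def
    by (intro min.mono add_mono nn_integral_mono order_refl)
qed

lemma decseq_trunc_V: "decseq (\<lambda>N. trunc_V \<mu> F l N n x)"
  by (rule decseq_SucI) (rule trunc_V_Suc_le)

lemma decseq_trunc_Q: "decseq (\<lambda>N. trunc_Q \<mu> F l N n x)"
  unfolding trunc_Q_def by (intro decseq_SucI add_mono nn_integral_mono trunc_V_Suc_le order_refl)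

text \<open>Thanks to the default value \<open>l\<close> of \<open>trunc_V\<close> the sequence is
  decreasing from \<open>N = 0\<close> on, so the infimum may run over all N.\<close>

lemma Qlim_eq_INF: "Qlim \<mu> F l n x = (INF N. trunc_Q \<mu> F l N n x)"
  unfolding Qlim_def by (intro limI LIMSEQ_INF decseq_trunc_Q)

text \<open>The recursion passes to the limit because the minimum is continuous. It is available for
  \<open>N > n\<close>, hence the argument with eventual equality.\<close>

lemma INF_trunc_V: "(INF N. trunc_V \<mu> F l N n x) = min (l n x) (Qlim \<mu> F l n x)"
proof (rule LIMSEQ_unique)
  show "(\<lambda>N. trunc_V \<mu> F l N n x) \<longlonglongrightarrow> (INF N. trunc_V \<mu> F l N n x)"
    by (intro LIMSEQ_INF decseq_trunc_V)
  have "(\<lambda>N. min (l n x) (trunc_Q \<mu> F l N n x)) \<longlonglongrightarrow> min (l n x) (Qlim \<mu> F l n x)"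
    unfolding Qlim_eq_INF by (intro tendsto_min tendsto_const LIMSEQ_INF decseq_trunc_Q)
  then show "(\<lambda>N. trunc_V \<mu> F l N n x) \<longlonglongrightarrow> min (l n x) (Qlim \<mu> F l n x)"
    by (rule Lim_transform_eventually)
      (use eventually_gt_at_top[of n] in eventually_elim, simp add: trunc_V_less)
qed

text \<open>The optimal stopping problem freed from parameter, process and decisions.
  \<open>F_consistent\<close> is consistency of the densities tested against functions of the first
  n observations, in place of a pointwise identity for the marginals.\<close>

locale stopping_problem = sigma_finite_measure \<mu> for \<mu> :: "'x measure" +
  fixes F l :: "nat \<Rightarrow> (nat \<Rightarrow> 'x) \<Rightarrow> ennreal"
  assumes F_measurable: "1 \<le> n \<Longrightarrow> F n \<in> borel_measurable (obs \<mu> n)"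
    and l_measurable: "1 \<le> n \<Longrightarrow> l n \<in> borel_measurable (obs \<mu> n)"
    and F_consistent: "1 \<le> n \<Longrightarrow> g \<in> borel_measurable (obs \<mu> n) \<Longrightarrow>
      (\<integral>\<^sup>+x. g (restrict x {1..n}) * F (Suc n) x \<partial>obs \<mu> (Suc n)) = (\<integral>\<^sup>+x. g x * F n x \<partial>obs \<mu> n)"
    and F_total: "(\<integral>\<^sup>+x. F 1 x \<partial>obs \<mu> 1) = 1"
    and l1_finite: "(\<integral>\<^sup>+x. l 1 x \<partial>obs \<mu> 1) < \<infinity>"
begin

abbreviation "V \<equiv> trunc_V \<mu> F l"
abbreviation "Q \<equiv> trunc_Q \<mu> F l"
abbreviation "QL \<equiv> Qlim \<mu> F l"

text \<open>This is \<open>V\<^sub>n\<close>: \<open>INF_trunc_V\<close> identifies it with the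
  limit of \<open>V\<^sub>n\<^sup>N\<close>.\<close>

definition VL :: "nat \<Rightarrow> (nat \<Rightarrow> 'x) \<Rightarrow> ennreal" where
  "VL n x = min (l n x) (QL n x)"

text \<open>The cost of following \<psi> before stage n and facing a prescribed future cost
  \<open>v n\<close> from then on. For \<open>v = V N\<close> it interpolates between
  \<open>1 + \<integral> V\<^sub>1\<^sup>N d\<mu>\<close> at \<open>n = 1\<close> and the truncated
  risk at \<open>n = N\<close>.\<close>

definition stage_risk :: "(nat \<Rightarrow> (nat \<Rightarrow> 'x) \<Rightarrow> ennreal) \<Rightarrow> (nat \<Rightarrow> (nat \<Rightarrow> 'x) \<Rightarrow> real) \<Rightarrow> nat \<Rightarrow> ennreal" where
  "stage_risk v \<psi> n = (\<Sum>m\<in>{1..<n}. stop_cost \<mu> F l \<psi> m)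
    + (\<integral>\<^sup>+x. ennreal (tpsi \<psi> n x) * (of_nat n * F n x + v n x) \<partial>obs \<mu> n)"

lemma trunc_risk_eq_stage_risk: "trunc_risk \<mu> F l N \<psi> = stage_risk (V N) \<psi> N"
  by (simp add: trunc_risk_def stage_risk_def trunc_V_self)

lemma nn_integral_obs_Suc:
  assumes g: "g \<in> borel_measurable (obs \<mu> (Suc n))"
  shows "integral\<^sup>N (obs \<mu> (Suc n)) g = (\<integral>\<^sup>+x. \<integral>\<^sup>+y. g (x(Suc n := y)) \<partial>\<mu> \<partial>obs \<mu> n)"
proof -
  interpret product_sigma_finite "\<lambda>_::nat. \<mu>" ..
  have *: "insert (Suc n) {1..n} = {1..Suc n}"
    by auto
  show ?thesis
    using product_nn_integral_insert[of "{1..n}" "Suc n" g] g unfolding * by (auto simp: obs_def)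
qed

lemma nn_integral_upd_measurable:
  assumes [measurable]: "g \<in> borel_measurable (obs \<mu> (Suc n))"
  shows "(\<lambda>x. \<integral>\<^sup>+y. g (x(Suc n := y)) \<partial>\<mu>) \<in> borel_measurable (obs \<mu> n)"
proof -
  have "(\<lambda>(x, y). g (x(Suc n := y))) \<in> borel_measurable (obs \<mu> n \<Otimes>\<^sub>M \<mu>)"
    using measurable_compose[OF measurable_obs_upd assms] by (simp add: split_beta')
  then show ?thesis
    by (rule borel_measurable_nn_integral)
qed

lemma V_measurable: "1 \<le> n \<Longrightarrow> V N n \<in> borel_measurable (obs \<mu> n)"
proof (induction "N - n" arbitrary: n)
  case 0
  then have "V N n = l n"
    by (subst trunc_V.simps[abs_def]) auto
  then show ?case
    using 0 l_measurable by simp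
next
  case (Suc d)
  then have n: "n < N" and *: "V N (Suc n) \<in> borel_measurable (obs \<mu> (Suc n))"
    by auto
  from n have "V N n = (\<lambda>x. min (l n x) (F n x + (\<integral>\<^sup>+y. V N (Suc n) (x(Suc n := y)) \<partial>\<mu>)))"
    by (auto simp: trunc_V_less trunc_Q_def)
  then show ?case
    using nn_integral_upd_measurable[OF *] l_measurable F_measurable Suc.prems by simp
qed

lemma Q_measurable: "1 \<le> n \<Longrightarrow> Q N n \<in> borel_measurable (obs \<mu> n)"
  unfolding trunc_Q_def[abs_def]
  by (intro borel_measurable_add F_measurable nn_integral_upd_measurable V_measurable) auto

lemma QL_measurable: "1 \<le> n \<Longrightarrow> QL n \<in> borel_measurable (obs \<mu> n)"
  unfolding Qlim_eq_INF[abs_def] by (intro borel_measurable_INF Q_measurable) auto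

lemma VL_measurable: "1 \<le> n \<Longrightarrow> VL n \<in> borel_measurable (obs \<mu> n)"
  unfolding VL_def[abs_def] by (intro borel_measurable_min l_measurable QL_measurable)

lemma VL_le_V: "VL n x \<le> V N n x"
  unfolding VL_def INF_trunc_V[symmetric] by (rule INF_lower) simp

section \<open>Lower bound for the truncated risks by backward induction\<close>

context
  fixes \<psi> assumes \<psi>: "stopping_rule \<mu> \<psi>"
begin

lemma measurability [measurable]:
  assumes "1 \<le> n"
  shows "tpsi \<psi> n \<in> borel_measurable (obs \<mu> n)" "tpsi \<psi> (Suc n) \<in> borel_measurable (obs \<mu> n)"
    "spsi \<psi> n \<in> borel_measurable (obs \<mu> n)" "F n \<in> borel_measurable (obs \<mu> n)"
    "l n \<in> borel_measurable (obs \<mu> n)" "V N n \<in> borel_measurable (obs \<mu> n)"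
    "Q N n \<in> borel_measurable (obs \<mu> n)" "QL n \<in> borel_measurable (obs \<mu> n)"
    "VL n \<in> borel_measurable (obs \<mu> n)"
  using assms tpsi_measurable[OF \<psi>, of _ n] spsi_measurable[OF \<psi>, of n]
  by (auto intro: F_measurable l_measurable V_measurable Q_measurable QL_measurable VL_measurable)

lemma nn_integral_tpsi_F_Suc:
  assumes n: "1 \<le> n"
  shows "(\<integral>\<^sup>+x. ennreal (tpsi \<psi> (Suc n) x) * F (Suc n) x \<partial>obs \<mu> (Suc n))
    = (\<integral>\<^sup>+x. ennreal (tpsi \<psi> (Suc n) x) * F n x \<partial>obs \<mu> n)"
  using F_consistent[OF n, of "\<lambda>x. ennreal (tpsi \<psi> (Suc n) x)"] measurability(2)[OF n]
  unfolding tpsi_restrict[OF order_refl] by simp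

text \<open>The last observation is integrated out: \<open>tpsi\<close> does not involve it, and
  consistency turns n + 1 copies of \<open>F (Suc n)\<close> into as many of \<open>F n\<close>. One
  copy is set apart, since together with the integral of \<open>v\<close> it forms the cost of
  continuing.\<close>

lemma nn_integral_tpsi_Suc:
  assumes n: "1 \<le> n" and v [measurable]: "v \<in> borel_measurable (obs \<mu> (Suc n))"
  shows "(\<integral>\<^sup>+x. ennreal (tpsi \<psi> (Suc n) x) * (of_nat (Suc n) * F (Suc n) x + v x) \<partial>obs \<mu> (Suc n))
    = (\<integral>\<^sup>+x. ennreal (tpsi \<psi> (Suc n) x) *
        (of_nat n * F n x + (F n x + (\<integral>\<^sup>+y. v (x(Suc n := y)) \<partial>\<mu>))) \<partial>obs \<mu> n)"
proof -
  note [measurable] = measurability[OF n] measurability[of "Suc n"] nn_integral_upd_measurable[OF v]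
  have "(\<integral>\<^sup>+x. ennreal (tpsi \<psi> (Suc n) x) * (of_nat (Suc n) * F (Suc n) x + v x) \<partial>obs \<mu> (Suc n))
    = of_nat (Suc n) * (\<integral>\<^sup>+x. ennreal (tpsi \<psi> (Suc n) x) * F (Suc n) x \<partial>obs \<mu> (Suc n))
      + (\<integral>\<^sup>+x. ennreal (tpsi \<psi> (Suc n) x) * v x \<partial>obs \<mu> (Suc n))"
    by (subst nn_integral_cmult[symmetric], measurable, subst nn_integral_add[symmetric])
      (auto simp: distrib_left mult_ac simp del: of_nat_Suc)
  also have "(\<integral>\<^sup>+x. ennreal (tpsi \<psi> (Suc n) x) * v x \<partial>obs \<mu> (Suc n))
    = (\<integral>\<^sup>+x. \<integral>\<^sup>+y. ennreal (tpsi \<psi> (Suc n) (x(Suc n := y))) * v (x(Suc n := y)) \<partial>\<mu> \<partial>obs \<mu> n)"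
    by (subst nn_integral_obs_Suc) auto
  also have "\<dots> = (\<integral>\<^sup>+x. ennreal (tpsi \<psi> (Suc n) x) * (\<integral>\<^sup>+y. v (x(Suc n := y)) \<partial>\<mu>) \<partial>obs \<mu> n)"
  proof (rule nn_integral_cong)
    fix x assume x: "x \<in> space (obs \<mu> n)"
    have "tpsi \<psi> (Suc n) (x(Suc n := y)) = tpsi \<psi> (Suc n) x" for y
      by (rule tpsi_cong) auto
    then show "(\<integral>\<^sup>+y. ennreal (tpsi \<psi> (Suc n) (x(Suc n := y))) * v (x(Suc n := y)) \<partial>\<mu>)
      = ennreal (tpsi \<psi> (Suc n) x) * (\<integral>\<^sup>+y. v (x(Suc n := y)) \<partial>\<mu>)"
      using measurable_compose[OF measurable_obs_upd2[OF x] v] by (simp add: nn_integral_cmult)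
  qed
  also note nn_integral_tpsi_F_Suc[OF n]
  also have "of_nat (Suc n) * (\<integral>\<^sup>+x. ennreal (tpsi \<psi> (Suc n) x) * F n x \<partial>obs \<mu> n)
      + (\<integral>\<^sup>+x. ennreal (tpsi \<psi> (Suc n) x) * (\<integral>\<^sup>+y. v (x(Suc n := y)) \<partial>\<mu>) \<partial>obs \<mu> n)
    = (\<integral>\<^sup>+x. ennreal (tpsi \<psi> (Suc n) x) *
        (of_nat n * F n x + (F n x + (\<integral>\<^sup>+y. v (x(Suc n := y)) \<partial>\<mu>))) \<partial>obs \<mu> n)"
    by (subst nn_integral_cmult[symmetric], measurable, subst nn_integral_add[symmetric])
      (auto simp: distrib_left distrib_right mult_ac add_ac intro!: nn_integral_cong)
  finally show ?thesis .
qed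

text \<open>Brings the risk at stage n + 1 to an integral over the same n observations as the risk
  at stage n, so that the two can be compared pointwise.\<close>

lemma stage_risk_Suc:
  assumes n: "1 \<le> n" and v: "v (Suc n) \<in> borel_measurable (obs \<mu> (Suc n))"
  shows "stage_risk v \<psi> (Suc n) = (\<Sum>m\<in>{1..<n}. stop_cost \<mu> F l \<psi> m) +
    (\<integral>\<^sup>+x. ennreal (spsi \<psi> n x) * (of_nat n * F n x + l n x) + ennreal (tpsi \<psi> (Suc n) x) *
        (of_nat n * F n x + (F n x + (\<integral>\<^sup>+y. v (Suc n) (x(Suc n := y)) \<partial>\<mu>))) \<partial>obs \<mu> n)"
proof -
  note [measurable] = measurability[OF n] nn_integral_upd_measurable[OF v]
  show ?thesis
    unfolding stage_risk_def nn_integral_tpsi_Suc[of n "v (Suc n)", OF n v] using n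
    by (subst nn_integral_add) (auto simp: stop_cost_def atLeastLessThanSuc add_ac)
qed

lemma tpsi_mult_mixture_ge:
  assumes "1 \<le> n" "x \<in> space (obs \<mu> n)" "v \<le> a" "v \<le> b"
  shows "ennreal (tpsi \<psi> n x) * (c + v) \<le> ennreal (spsi \<psi> n x) * (c + a) + ennreal (tpsi \<psi> (Suc n) x) * (c + b)"
proof -
  have "ennreal (tpsi \<psi> n x) * (c + v) = ennreal (spsi \<psi> n x) * (c + v) + ennreal (tpsi \<psi> (Suc n) x) * (c + v)"
    using assms by (simp add: ennreal_spsi_add_tpsi_Suc[OF \<psi>, symmetric] distrib_right)
  also have "\<dots> \<le> ennreal (spsi \<psi> n x) * (c + a) + ennreal (tpsi \<psi> (Suc n) x) * (c + b)"
    using assms by (intro add_mono mult_left_mono) auto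
  finally show ?thesis .
qed

text \<open>With N fixed, one step replaces the minimum of \<open>l\<close> and \<open>Q N\<close>
  at stage m by the mixture of both that \<psi> chooses, which cannot be smaller.\<close>

lemma stage_risk_V_mono:
  assumes "1 \<le> n" "n \<le> m" "m \<le> N"
  shows "stage_risk (V N) \<psi> n \<le> stage_risk (V N) \<psi> m"
  using assms(2,3)
proof (induction m rule: dec_induct)
  case (step m)
  then have m: "1 \<le> m" "m < N"
    using assms(1) by auto
  have "stage_risk (V N) \<psi> m \<le> stage_risk (V N) \<psi> (Suc m)"
    unfolding stage_risk_Suc[of m "V N", OF m(1) V_measurable[of "Suc m" N, OF le_SucI[OF m(1)]]] unfolding stage_risk_def
    by (intro add_left_mono nn_integral_mono tpsi_mult_mixture_ge[of m])
      (use m in \<open>auto simp: trunc_V_less trunc_Q_def\<close>)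
  with step show ?case
    by auto
qed simp

lemma stage_risk_1: "v 1 \<in> borel_measurable (obs \<mu> 1) \<Longrightarrow> stage_risk v \<psi> 1 = 1 + (\<integral>\<^sup>+x. v 1 x \<partial>obs \<mu> 1)"
  using F_total measurability(4)[of 1] by (simp add: stage_risk_def nn_integral_add)

lemma trunc_risk_ge:
  assumes "1 \<le> N"
  shows "1 + (\<integral>\<^sup>+x. VL 1 x \<partial>obs \<mu> 1) \<le> trunc_risk \<mu> F l N \<psi>"
proof -
  have "1 + (\<integral>\<^sup>+x. VL 1 x \<partial>obs \<mu> 1) \<le> stage_risk (V N) \<psi> 1"
    by (subst stage_risk_1) (auto intro!: V_measurable nn_integral_mono VL_le_V)
  also have "\<dots> \<le> stage_risk (V N) \<psi> N"
    using assms by (intro stage_risk_V_mono) auto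
  finally show ?thesis
    by (simp add: trunc_risk_eq_stage_risk)
qed

end

text \<open>Only this inequality is available: if all \<open>Q\<^sub>n\<^sup>N(x)\<close> are infinite, then \<open>Q\<^sub>n(x) = \<infinity>\<close>, while the left-hand
  side may be finite.\<close>

lemma F_plus_VL_le_QL: "F n x + (\<integral>\<^sup>+y. VL (Suc n) (x(Suc n := y)) \<partial>\<mu>) \<le> QL n x"
  unfolding Qlim_eq_INF trunc_Q_def by (intro INF_greatest add_left_mono nn_integral_mono VL_le_V)

lemma initial_VL_finite: "1 + (\<integral>\<^sup>+x. VL 1 x \<partial>obs \<mu> 1) < \<infinity>"
proof -
  have "(\<integral>\<^sup>+x. VL 1 x \<partial>obs \<mu> 1) \<le> (\<integral>\<^sup>+x. l 1 x \<partial>obs \<mu> 1)"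
    by (intro nn_integral_mono) (simp add: VL_def)
  with l1_finite show ?thesis
    by (auto simp: less_top)
qed

text \<open>The risk in terms of \<open>F\<close> alone, without the underlying process; it agrees
  with \<open>risk\<close> when \<open>F\<close> is the mixture density.\<close>

definition stopping_risk :: "(nat \<Rightarrow> (nat \<Rightarrow> 'x) \<Rightarrow> real) \<Rightarrow> ennreal" where
  "stopping_risk \<psi> = (if (\<Sum>n. \<integral>\<^sup>+x. ennreal (spsi \<psi> (Suc n) x) * F (Suc n) x \<partial>obs \<mu> (Suc n)) = 1
    then (\<Sum>n. stop_cost \<mu> F l \<psi> (Suc n)) else \<infinity>)"

section \<open>Upper bound for rules of the optimal form, and the case of equality\<close>

context
  fixes \<psi> assumes \<psi>: "stopping_rule \<mu> \<psi>"
begin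

text \<open>A rule of the optimal form mixes \<open>l n\<close> and \<open>QL n\<close> exactly to
  their minimum \<open>VL n\<close>. The inequality enters through \<open>F_plus_VL_le_QL\<close>,
  as the continuation cost built from \<open>VL (Suc n)\<close> is at most
  \<open>QL n\<close>.\<close>

lemma stage_risk_VL_antimono:
  assumes form: "optimal_form \<mu> F l \<psi>" and n: "1 \<le> n"
  shows "stage_risk VL \<psi> (Suc n) \<le> stage_risk VL \<psi> n"
proof -
  have "AE x in obs \<mu> n. ennreal (spsi \<psi> n x) * (of_nat n * F n x + l n x) + ennreal (tpsi \<psi> (Suc n) x) *
      (of_nat n * F n x + (F n x + (\<integral>\<^sup>+y. VL (Suc n) (x(Suc n := y)) \<partial>\<mu>)))
    \<le> ennreal (tpsi \<psi> n x) * (of_nat n * F n x + VL n x)" (is "AE x in _. ?L x \<le> ?R x")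
    using form[unfolded optimal_form_def, rule_format, OF n] AE_space
  proof eventually_elim
    case (elim x)
    note bounds = stopping_rule_bounds[OF \<psi> n elim(2)]
    have "?L x \<le> ennreal (spsi \<psi> n x) * (of_nat n * F n x + l n x)
        + ennreal (tpsi \<psi> (Suc n) x) * (of_nat n * F n x + QL n x)"
      by (intro add_left_mono mult_left_mono F_plus_VL_le_QL) auto
    also have "\<dots> = ennreal (tpsi \<psi> n x) * (ennreal (\<psi> n x) * (of_nat n * F n x + l n x)
        + ennreal (1 - \<psi> n x) * (of_nat n * F n x + QL n x))"
      using n elim(2) by (simp add: ennreal_spsi[OF \<psi>] ennreal_tpsi_Suc[OF \<psi>] distrib_left mult.assoc)
    also have "\<dots> = ?R x"
    \<comment> \<open>Outside \<open>Tset\<close> both sides carry the factor 0; on it the optimal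
      form decides.\<close>
    proof (cases "tpsi \<psi> n x = 0")
      case False
      then have T: "x \<in> Tset \<mu> \<psi> n"
        using tpsi_nonneg[OF \<psi> elim(2), of n] elim(2) by (auto simp: Tset_def)
      consider "l n x < QL n x" | "QL n x < l n x" | "l n x = QL n x"
        by fastforce
      then show ?thesis
      proof cases
        case 1
        with elim(1) T bounds have "\<psi> n x = 1"
          by (auto simp: indicator_def)
        with 1 show ?thesis
          by (simp add: VL_def min_absorb1)
      next
        case 2
        with elim(1) T bounds have "\<psi> n x = 0"
          by (auto simp: indicator_def not_le[symmetric])
        with 2 show ?thesis
          by (simp add: VL_def min_absorb2)
      next
        \<comment> \<open>In a tie the value of \<open>\<psi> n x\<close> is free, and only the sum
          of the two weights counts.\<close>
        case 3
        have "ennreal (\<psi> n x) + ennreal (1 - \<psi> n x) = 1"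
          using bounds by (subst ennreal_plus[symmetric]) auto
        with 3 show ?thesis
          by (simp add: VL_def flip: distrib_right)
      qed
    qed simp
    finally show ?case .
  qed
  then show ?thesis
    unfolding stage_risk_Suc[of \<psi> n VL, OF \<psi> n VL_measurable[OF le_SucI[OF n]]] unfolding stage_risk_def
    by (intro add_left_mono nn_integral_mono_AE)
qed

text \<open>Mass is preserved from stage to stage: by consistency the next remainder can be computed
  on the present observation space, where it and the mass stopped now add up to the present
  remainder.\<close>

lemma nn_integral_stopped_plus_unstopped:
  "(\<Sum>m\<in>{1..<Suc n}. \<integral>\<^sup>+x. ennreal (spsi \<psi> m x) * F m x \<partial>obs \<mu> m)
    + (\<integral>\<^sup>+x. ennreal (tpsi \<psi> (Suc n) x) * F (Suc n) x \<partial>obs \<mu> (Suc n)) = 1"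
proof (induction n)
  case 0
  then show ?case
    using F_total by simp
next
  case (Suc n)
  note [measurable] = measurability[OF \<psi>, of "Suc n", simplified]
  have "(\<integral>\<^sup>+x. ennreal (spsi \<psi> (Suc n) x) * F (Suc n) x \<partial>obs \<mu> (Suc n))
      + (\<integral>\<^sup>+x. ennreal (tpsi \<psi> (Suc (Suc n)) x) * F (Suc (Suc n)) x \<partial>obs \<mu> (Suc (Suc n)))
    = (\<integral>\<^sup>+x. (ennreal (spsi \<psi> (Suc n) x) + ennreal (tpsi \<psi> (Suc (Suc n)) x)) * F (Suc n) x \<partial>obs \<mu> (Suc n))"
    by (subst nn_integral_tpsi_F_Suc[OF \<psi>]) (auto simp: distrib_right nn_integral_add)
  also have "\<dots> = (\<integral>\<^sup>+x. ennreal (tpsi \<psi> (Suc n) x) * F (Suc n) x \<partial>obs \<mu> (Suc n))"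
    by (intro nn_integral_cong) (simp add: ennreal_spsi_add_tpsi_Suc[OF \<psi>])
  finally show ?case
    using Suc unfolding sum_from_1_eq by (simp add: add.assoc)
qed

lemma stage_risk_VL_le:
  assumes "optimal_form \<mu> F l \<psi>"
  shows "stage_risk VL \<psi> (Suc n) \<le> 1 + (\<integral>\<^sup>+x. VL 1 x \<partial>obs \<mu> 1)"
proof (induction n)
  case 0
  then show ?case
    using stage_risk_1[OF \<psi>, of VL] VL_measurable[of 1] by simp
next
  case (Suc n)
  then show ?case
    using stage_risk_VL_antimono[OF assms, of "Suc n"] by auto
qed

lemma stopping_risk_le:
  assumes form: "optimal_form \<mu> F l \<psi>"
  shows "stopping_risk \<psi> \<le> 1 + (\<integral>\<^sup>+x. VL 1 x \<partial>obs \<mu> 1)" (is "_ \<le> ?C")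
proof -
  define p where "p m = (\<integral>\<^sup>+x. ennreal (spsi \<psi> m x) * F m x \<partial>obs \<mu> m)" for m
  define r where "r n = (\<integral>\<^sup>+x. ennreal (tpsi \<psi> n x) * F n x \<partial>obs \<mu> n)" for n
  have le: "stage_risk VL \<psi> (Suc n) \<le> ?C" for n
    by (rule stage_risk_VL_le[OF form])
  obtain c where c: "?C = ennreal c" "0 \<le> c"
    using initial_VL_finite by (cases ?C) auto
  have "(\<Sum>n. stop_cost \<mu> F l \<psi> (Suc n)) \<le> ?C"
  proof (rule suminf_le_const[OF summableI])
    fix n
    have "(\<Sum>m<n. stop_cost \<mu> F l \<psi> (Suc m)) \<le> stage_risk VL \<psi> (Suc n)"
      unfolding stage_risk_def sum_from_1_eq by (rule order_trans[OF _ add_increasing2]) auto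
    with le show "(\<Sum>m<n. stop_cost \<mu> F l \<psi> (Suc m)) \<le> ?C"
      by (rule order_trans[rotated])
  qed
  \<comment> \<open>Bounded costs are not enough: without stopping probability 1,
    \<open>stopping_risk\<close> is infinite by definition.\<close>
  moreover have "(\<Sum>n. p (Suc n)) = 1"
  proof -
    have one: "(\<Sum>m<n. p (Suc m)) + r (Suc n) = 1" for n
      using nn_integral_stopped_plus_unstopped[of n] unfolding sum_from_1_eq p_def r_def .
    have "r (Suc n) \<le> ennreal (c / real (Suc n))" for n
    proof -
      note [measurable] = measurability[OF \<psi>, of "Suc n", simplified]
      have "of_nat (Suc n) * r (Suc n) = (\<integral>\<^sup>+x. ennreal (tpsi \<psi> (Suc n) x) * (of_nat (Suc n) * F (Suc n) x) \<partial>obs \<mu> (Suc n))"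
        unfolding r_def by (subst nn_integral_cmult[symmetric]) (auto simp: mult_ac simp del: of_nat_Suc)
      also have "\<dots> \<le> (\<integral>\<^sup>+x. ennreal (tpsi \<psi> (Suc n) x) * (of_nat (Suc n) * F (Suc n) x + VL (Suc n) x) \<partial>obs \<mu> (Suc n))"
        by (intro nn_integral_mono mult_left_mono) (auto simp del: of_nat_Suc)
      also have "\<dots> \<le> stage_risk VL \<psi> (Suc n)"
        unfolding stage_risk_def by (intro add_increasing) auto
      also have "\<dots> \<le> ennreal c"
        using le c by simp
      finally have *: "of_nat (Suc n) * r (Suc n) \<le> ennreal c" .
      \<comment> \<open>This makes \<open>r (Suc n)\<close> a real number, so that the division
        takes place in the reals.\<close>
      have "r (Suc n) \<le> 1"
        using one[of n] by (metis add_increasing order_refl zero_le)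
      then obtain q where q: "r (Suc n) = ennreal q" "0 \<le> q"
        by (cases "r (Suc n)") (auto simp: top_unique)
      with * have "ennreal (real (Suc n) * q) \<le> ennreal c"
        by (simp add: ennreal_mult ennreal_of_nat_eq_real_of_nat del: of_nat_Suc)
      then have "real (Suc n) * q \<le> c"
        using c(2) by (simp only: ennreal_le_iff)
      then have "q \<le> c / real (Suc n)"
        by (subst pos_le_divide_eq) (simp_all add: mult.commute)
      then show ?thesis
        using q by (simp add: ennreal_leI del: of_nat_Suc)
    qed
    then have "(\<lambda>n. r (Suc n)) \<longlonglongrightarrow> 0"
      by (rule tendsto_0_if_le_const_over_Suc)
    then show ?thesis
      using one by (rule suminf_eq_1_if_remainder_tendsto_0)
  qed
  ultimately show ?thesis
    by (simp add: stopping_risk_def p_def)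
qed

text \<open>The convergence assumed here is what truncatability supplies; it carries the lower
  bound, uniform in \<open>N \<ge> 1\<close>, over to the limit.\<close>

lemma stopping_risk_ge:
  assumes "(\<lambda>N. trunc_risk \<mu> F l N \<psi>) \<longlonglongrightarrow> R"
  shows "1 + (\<integral>\<^sup>+x. VL 1 x \<partial>obs \<mu> 1) \<le> R"
  using trunc_risk_ge[OF \<psi>] by (intro LIMSEQ_le_const[OF assms]) blast

text \<open>Letting N grow in the backward induction gives \<open>C \<le> K + \<integral> u (VL n)
  \<le> K + \<integral> h (QL n) \<le> R\<close> for each stage n. With \<open>R \<le> C\<close> the
  integrals in the middle agree; their integrands are ordered pointwise, so they agree almost
  everywhere, and \<open>mixture_eq_min_imp\<close> reads off \<psi>.\<close>

lemma optimal_form_if_stopping_risk_minimal: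
  assumes lim: "(\<lambda>N. trunc_risk \<mu> F l N \<psi>) \<longlonglongrightarrow> R"
    and R: "R \<le> 1 + (\<integral>\<^sup>+x. VL 1 x \<partial>obs \<mu> 1)" (is "_ \<le> ?C")
  shows "optimal_form \<mu> F l \<psi>"
  unfolding optimal_form_def
proof (intro allI impI)
  fix n :: nat
  assume n: "1 \<le> n"
  note [measurable] = measurability[OF \<psi> n]
  \<comment> \<open>\<open>K\<close> collects the cost of stopping before stage n,
    \<open>u v\<close> is the integrand at stage n with future cost \<open>v\<close>, and
    \<open>h q\<close> is the integrand after \<psi> has chosen between stopping and continuing at
    cost \<open>q\<close>.\<close>
  define K where "K = (\<Sum>m\<in>{1..<n}. stop_cost \<mu> F l \<psi> m)"
  define u where "u v x = ennreal (tpsi \<psi> n x) * (of_nat n * F n x + v x)" for v x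
  define h where "h q x = ennreal (spsi \<psi> n x) * (of_nat n * F n x + l n x)
    + ennreal (tpsi \<psi> (Suc n) x) * (of_nat n * F n x + q x)" for q x
  have [measurable]: "u v \<in> borel_measurable (obs \<mu> n)" "h v \<in> borel_measurable (obs \<mu> n)"
    if [measurable]: "v \<in> borel_measurable (obs \<mu> n)" for v
    unfolding u_def[abs_def] h_def[abs_def] by measurable
  have u: "stage_risk (V N) \<psi> n = K + integral\<^sup>N (obs \<mu> n) (u (V N n))" for N
    by (simp add: stage_risk_def u_def[abs_def] K_def)
  have h: "stage_risk (V N) \<psi> (Suc n) = K + integral\<^sup>N (obs \<mu> n) (h (Q N n))" for N
    unfolding stage_risk_Suc[of \<psi> n "V N", OF \<psi> n V_measurable[OF le_SucI[OF n]]]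
    by (simp add: h_def[abs_def] K_def trunc_Q_def)
  have "R < \<infinity>"
    using R initial_VL_finite by (rule order_le_less_trans)
  \<comment> \<open>Finiteness of the truncated risks makes the functions \<open>V\<^sub>n\<^sup>N\<close> eventually integrable against \<open>t\<^sub>n\<close>, although
    \<open>l\<^sub>n\<close> itself need not be.\<close>
  from order_tendstoD(2)[OF lim this] obtain N0 where N0: "\<And>N. N \<ge> N0 \<Longrightarrow> trunc_risk \<mu> F l N \<psi> < \<infinity>"
    by (auto simp: eventually_sequentially)
  \<comment> \<open>At least \<open>Suc n\<close>, so that stages n and n + 1 both lie within the
    horizon; at least \<open>N0\<close>, so that the truncated risk is finite.\<close>
  define N1 where "N1 = max N0 (Suc n)"
  have chain: "?C \<le> K + integral\<^sup>N (obs \<mu> n) (u (V N n))" "K + integral\<^sup>N (obs \<mu> n) (u (V N n)) \<le> trunc_risk \<mu> F l N \<psi>"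
    "K + integral\<^sup>N (obs \<mu> n) (h (Q N n)) \<le> trunc_risk \<mu> F l N \<psi>" if "N1 \<le> N" for N
  proof -
    have N: "Suc n \<le> N"
      using that by (simp add: N1_def)
    have "?C \<le> stage_risk (V N) \<psi> 1"
      by (subst stage_risk_1[OF \<psi>]) (auto intro!: V_measurable nn_integral_mono VL_le_V)
    also have "\<dots> \<le> stage_risk (V N) \<psi> n"
      using N n by (intro stage_risk_V_mono[OF \<psi>]) auto
    finally show "?C \<le> K + integral\<^sup>N (obs \<mu> n) (u (V N n))"
      by (simp add: u)
    show "K + integral\<^sup>N (obs \<mu> n) (u (V N n)) \<le> trunc_risk \<mu> F l N \<psi>"
      "K + integral\<^sup>N (obs \<mu> n) (h (Q N n)) \<le> trunc_risk \<mu> F l N \<psi>"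
      unfolding u[symmetric] h[symmetric] trunc_risk_eq_stage_risk
      using N n by (auto intro!: stage_risk_V_mono[OF \<psi>])
  qed
  have "K + integral\<^sup>N (obs \<mu> n) (u (V N1 n)) < \<infinity>"
    using chain(2)[OF order_refl] by (rule order_le_less_trans) (simp add: N0[unfolded infinity_ennreal_def] N1_def)
  then have fin: "integral\<^sup>N (obs \<mu> n) (u (V N1 n)) < \<infinity>"
    by simp
  \<comment> \<open>\<open>V N n\<close> decreases in N, so the function at \<open>N1\<close>, just
    seen to have a finite integral, dominates all later ones.\<close>
  have "(\<lambda>i. integral\<^sup>N (obs \<mu> n) (u (V (i + N1) n))) \<longlonglongrightarrow> integral\<^sup>N (obs \<mu> n) (u (VL n))"
  proof (rule nn_integral_dominated_convergence[where w="u (V N1 n)"])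
    show "AE x in obs \<mu> n. u (V (i + N1) n) x \<le> u (V N1 n) x" for i
      unfolding u_def by (intro AE_I2 mult_left_mono add_left_mono decseqD[OF decseq_trunc_V]) auto
    show "AE x in obs \<mu> n. (\<lambda>i. u (V (i + N1) n) x) \<longlonglongrightarrow> u (VL n) x"
      unfolding u_def VL_def INF_trunc_V[symmetric]
      by (intro AE_I2 ennreal_tendsto_cmult tendsto_add tendsto_const
          LIMSEQ_ignore_initial_segment[OF LIMSEQ_INF[OF decseq_trunc_V]]) auto
  qed (use fin in auto)
  then have "(\<lambda>i. K + integral\<^sup>N (obs \<mu> n) (u (V (i + N1) n))) \<longlonglongrightarrow> K + integral\<^sup>N (obs \<mu> n) (u (VL n))"
    by (intro tendsto_add tendsto_const)
  then have C_le: "?C \<le> K + integral\<^sup>N (obs \<mu> n) (u (VL n))"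
    by (rule LIMSEQ_le_const) (blast intro: chain(1) le_add2)
  \<comment> \<open>For \<open>h\<close> monotonicity suffices, since \<open>QL n\<close> lies below
    every \<open>Q N n\<close>.\<close>
  have "K + integral\<^sup>N (obs \<mu> n) (h (QL n)) \<le> R"
  proof (rule LIMSEQ_le_const[OF lim])
    have "K + integral\<^sup>N (obs \<mu> n) (h (QL n)) \<le> K + integral\<^sup>N (obs \<mu> n) (h (Q N n))" for N
      unfolding h_def Qlim_eq_INF by (intro add_left_mono nn_integral_mono mult_left_mono INF_lower) auto
    then show "\<exists>N. \<forall>m\<ge>N. K + integral\<^sup>N (obs \<mu> n) (h (QL n)) \<le> trunc_risk \<mu> F l m \<psi>"
      by (intro exI[of _ N1]) (meson chain(3) order_trans)
  qed
  with C_le R have le: "K + integral\<^sup>N (obs \<mu> n) (h (QL n)) \<le> K + integral\<^sup>N (obs \<mu> n) (u (VL n))"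
    by order
  have uh: "u (VL n) x \<le> h (QL n) x" if "x \<in> space (obs \<mu> n)" for x
    unfolding u_def h_def VL_def by (intro tpsi_mult_mixture_ge[OF \<psi> n that]) auto
  have hfin: "K + integral\<^sup>N (obs \<mu> n) (h (QL n)) < \<infinity>"
    using \<open>K + integral\<^sup>N (obs \<mu> n) (h (QL n)) \<le> R\<close> \<open>R < \<infinity>\<close> by order
  have "AE x in obs \<mu> n. u (VL n) x = h (QL n) x"
  proof (rule nn_integral_eq_imp_AE_eq)
    have "integral\<^sup>N (obs \<mu> n) (h (QL n)) \<le> integral\<^sup>N (obs \<mu> n) (u (VL n))"
      using le hfin by (auto simp: ennreal_add_left_cancel_le)
    moreover have "integral\<^sup>N (obs \<mu> n) (u (VL n)) \<le> integral\<^sup>N (obs \<mu> n) (h (QL n))"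
      by (intro nn_integral_mono uh)
    ultimately show "integral\<^sup>N (obs \<mu> n) (u (VL n)) = integral\<^sup>N (obs \<mu> n) (h (QL n))"
      by simp
  qed (use uh hfin in auto)
  \<comment> \<open>Excludes points at which both sides are infinite and equality carries no
    information about \<psi>.\<close>
  moreover have "AE x in obs \<mu> n. h (QL n) x \<noteq> \<infinity>"
    by (rule nn_integral_PInf_AE) (use hfin in auto)
  ultimately show "AE x\<in>Tset \<mu> \<psi> n in obs \<mu> n.
       indicator {x. l n x < QL n x} x \<le> \<psi> n x \<and> \<psi> n x \<le> indicator {x. l n x \<le> QL n x} x"
    using AE_space
  proof eventually_elim
    case (elim x)
    show ?case
    proof
      assume "x \<in> Tset \<mu> \<psi> n"
      then have "0 < tpsi \<psi> n x"
        by (simp add: Tset_def)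
      have eq: "ennreal (tpsi \<psi> n x) * (of_nat n * F n x + min (l n x) (QL n x)) =
        ennreal (tpsi \<psi> n x) * ennreal (\<psi> n x) * (of_nat n * F n x + l n x) +
        ennreal (tpsi \<psi> n x) * ennreal (1 - \<psi> n x) * (of_nat n * F n x + QL n x)"
        using elim(1) unfolding u_def h_def VL_def ennreal_spsi[OF \<psi> n elim(3)] ennreal_tpsi_Suc[OF \<psi> n elim(3)] .
      have fin: "ennreal (tpsi \<psi> n x) * (of_nat n * F n x + min (l n x) (QL n x)) \<noteq> \<infinity>"
        using elim(2) unfolding elim(1)[symmetric] unfolding u_def VL_def .
      note bounds = stopping_rule_bounds[OF \<psi> n elim(3)]
      have "l n x < QL n x \<Longrightarrow> \<psi> n x = 1" "QL n x < l n x \<Longrightarrow> \<psi> n x = 0"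
        using mixture_eq_min_imp[OF \<open>0 < tpsi \<psi> n x\<close> conjunct1[OF bounds] conjunct2[OF bounds] eq fin] by blast+
      then show "indicator {x. l n x < QL n x} x \<le> \<psi> n x \<and> \<psi> n x \<le> indicator {x. l n x \<le> QL n x} x"
        using bounds by (cases "l n x" "QL n x" rule: linorder_cases) (auto simp: indicator_def)
    qed
  qed
qed

end
end

section \<open>The distribution of the randomized stopping time\<close>

lemma emeasure_uniform_greaterThan:
  assumes "0 \<le> c" "c \<le> 1"
  shows "emeasure (uniform_measure lborel {0..1}) {c<..} = ennreal (1 - c)"
proof -
  have "{0..1} \<inter> {c<..} = {c<..1::real}"
    using assms by auto
  with assms show ?thesis
    by (simp add: divide_ennreal[of _ 1, simplified])
qed

lemma emeasure_uniform_atMost: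
  assumes "0 \<le> c" "c \<le> 1"
  shows "emeasure (uniform_measure lborel {0..1}) {..c} = ennreal c"
proof -
  have "{0..1} \<inter> {..c} = {0..c::real}"
    using assms by auto
  with assms show ?thesis
    by (simp add: divide_ennreal[of _ 1, simplified])
qed

lemma stop_time_eq_enat_iff:
  assumes "1 \<le> n"
  shows "stop_time X U \<psi> \<omega> = enat n \<longleftrightarrow>
    (\<forall>i\<in>{1..<n}. \<psi> i (Xvec X i \<omega>) < U i \<omega>) \<and> U n \<omega> \<le> \<psi> n (Xvec X n \<omega>)"
    (is "_ \<longleftrightarrow> _ \<and> ?P n")
proof
  assume *: "stop_time X U \<psi> \<omega> = enat n"
  then have ex: "\<exists>n. 1 \<le> n \<and> ?P n" and n: "n = (LEAST n. 1 \<le> n \<and> ?P n)"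
    by (auto simp: stop_time_def split: if_splits)
  show "(\<forall>i\<in>{1..<n}. \<psi> i (Xvec X i \<omega>) < U i \<omega>) \<and> ?P n"
    using LeastI_ex[OF ex] not_less_Least[of _ "\<lambda>n. 1 \<le> n \<and> ?P n"] unfolding n[symmetric]
    by (auto simp: not_le[symmetric])
next
  assume *: "(\<forall>i\<in>{1..<n}. \<psi> i (Xvec X i \<omega>) < U i \<omega>) \<and> ?P n"
  with assms have "(LEAST n. 1 \<le> n \<and> ?P n) = n"
    by (intro Least_equality) (auto simp: not_le[symmetric])
  with assms * show "stop_time X U \<psi> \<omega> = enat n"
    by (auto simp: stop_time_def)
qed

text \<open>The least index is taken over \<open>n \<ge> 1\<close>, so the value 0 does not occur
  and the positive stages exhaust the finite values.\<close>

lemma stop_time_eq_infinity_iff: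
  "stop_time X U \<psi> \<omega> = \<infinity> \<longleftrightarrow> (\<forall>n. stop_time X U \<psi> \<omega> \<noteq> enat (Suc n))"
proof -
  have "stop_time X U \<psi> \<omega> \<noteq> enat 0"
  proof
    assume "stop_time X U \<psi> \<omega> = enat 0"
    then have ex: "\<exists>n. 1 \<le> n \<and> U n \<omega> \<le> \<psi> n (Xvec X n \<omega>)"
      and "0 = (LEAST n. 1 \<le> n \<and> U n \<omega> \<le> \<psi> n (Xvec X n \<omega>))"
      by (auto simp: stop_time_def split: if_splits)
    with LeastI_ex[OF ex] show False
      by simp
  qed
  then show ?thesis
    by (metis enat.exhaust infinity_ne_i0 not0_implies_Suc enat.distinct(1))
qed

context sequential_model
begin

lemma sigma_finite_obs: "sigma_finite_measure (obs \<mu> n)"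
proof -
  interpret \<mu>: sigma_finite_measure \<mu>
    by (rule sigma_finite)
  interpret product_sigma_finite "\<lambda>_::nat. \<mu>" ..
  show ?thesis
    unfolding obs_def by (rule sigma_finite) auto
qed

section \<open>Joint distribution of the observations and the randomization variables\<close>

lemma Xvec_measurable: "\<theta> \<in> space Th \<Longrightarrow> 1 \<le> n \<Longrightarrow> Xvec X n \<in> measurable (P \<theta>) (obs \<mu> n)"
  using distributed_measurable[OF X_density] by simp

lemma nn_integral_Xvec:
  "\<theta> \<in> space Th \<Longrightarrow> 1 \<le> n \<Longrightarrow> g \<in> borel_measurable (obs \<mu> n) \<Longrightarrow>
    (\<integral>\<^sup>+\<omega>. g (Xvec X n \<omega>) \<partial>P \<theta>) = (\<integral>\<^sup>+x. ennreal (f n \<theta> x) * g x \<partial>obs \<mu> n)"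
  by (rule distributed_nn_integral[OF X_density, symmetric])

lemma U_measurable:
  assumes "\<theta> \<in> space Th" "1 \<le> n"
  shows "U n \<in> borel_measurable (P \<theta>)"
proof -
  interpret prob_space "P \<theta>"
    using assms by (rule_tac prob)
  show ?thesis
    using U_indep[OF assms(1)] assms(2) by (auto simp: indep_vars_def)
qed

lemma distr_U:
  assumes \<theta>: "\<theta> \<in> space Th" and n: "1 \<le> n"
  shows "distr (P \<theta>) (PiM {1..n} (\<lambda>_. borel)) (\<lambda>\<omega>. \<lambda>i\<in>{1..n}. U i \<omega>)
    = PiM {1..n} (\<lambda>_. uniform_measure lborel {0..1})"
proof -
  interpret prob_space "P \<theta>"
    using \<theta> by (rule prob)
  have "indep_vars (\<lambda>_. borel) U {1..n}"
    using U_indep[OF \<theta>] by (rule indep_vars_subset) auto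
  then have "distr (P \<theta>) (PiM {1..n} (\<lambda>_. borel)) (\<lambda>\<omega>. \<lambda>i\<in>{1..n}. U i \<omega>)
    = PiM {1..n} (\<lambda>i. distr (P \<theta>) borel (U i))"
    using n \<theta> by (subst (asm) indep_vars_iff_distr_eq_PiM') (auto intro: U_measurable)
  also have "\<dots> = PiM {1..n} (\<lambda>_. uniform_measure lborel {0..1})"
    using \<theta> by (intro PiM_cong) (auto simp: U_uniform)
  finally show ?thesis .
qed

text \<open>The independence assumption concerns the sigma-algebras of the two infinite sequences.
  Events about the first n coordinates are preimages of cylinders and lie in them, and independence
  on rectangles determines the joint law.\<close>

lemma distr_U_Xvec:
  assumes \<theta>: "\<theta> \<in> space Th" and n: "1 \<le> n"
  shows "distr (P \<theta>) (PiM {1..n} (\<lambda>_. borel) \<Otimes>\<^sub>M obs \<mu> n) (\<lambda>\<omega>. (\<lambda>i\<in>{1..n}. U i \<omega>, Xvec X n \<omega>))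
    = PiM {1..n} (\<lambda>_. uniform_measure lborel {0..1}) \<Otimes>\<^sub>M distr (P \<theta>) (obs \<mu> n) (Xvec X n)"
proof -
  interpret prob_space "P \<theta>"
    using \<theta> by (rule prob)
  let ?B = "PiM {1..n} (\<lambda>_. borel :: real measure)"
  let ?U = "\<lambda>\<omega>. \<lambda>i\<in>{1..n}. U i \<omega>"
  have U [measurable]: "?U \<in> measurable (P \<theta>) ?B"
    using \<theta> by (intro measurable_restrict U_measurable) auto
  note [measurable] = Xvec_measurable[OF \<theta> n]
  have "distr (P \<theta>) ?B ?U \<Otimes>\<^sub>M distr (P \<theta>) (obs \<mu> n) (Xvec X n)
    = distr (P \<theta>) (?B \<Otimes>\<^sub>M obs \<mu> n) (\<lambda>\<omega>. (?U \<omega>, Xvec X n \<omega>))"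
  proof (rule pair_measure_eqI)
    show "sigma_finite_measure (distr (P \<theta>) ?B ?U)" "sigma_finite_measure (distr (P \<theta>) (obs \<mu> n) (Xvec X n))"
      by (intro prob_space_imp_sigma_finite prob_space_distr U Xvec_measurable[OF \<theta> n])+
    fix A B
    assume "A \<in> sets (distr (P \<theta>) ?B ?U)" "B \<in> sets (distr (P \<theta>) (obs \<mu> n) (Xvec X n))"
    then have A [measurable]: "A \<in> sets ?B" and B [measurable]: "B \<in> sets (obs \<mu> n)"
      by (simp_all only: sets_distr)
    let ?UI = "\<lambda>\<omega>. \<lambda>i\<in>{1..}. U i \<omega>" and ?XI = "\<lambda>\<omega>. \<lambda>i\<in>{1..}. X i \<omega>"
    let ?UA = "?U -` A \<inter> space (P \<theta>)" and ?XB = "Xvec X n -` B \<inter> space (P \<theta>)"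
    have "(\<lambda>u. restrict u {1..n}) -` A \<inter> space (PiM {1..} (\<lambda>_. borel)) \<in> sets (PiM {1..} (\<lambda>_. borel))"
      by (rule measurable_sets[OF measurable_restrict_subset A]) auto
    from in_vimage_algebra[OF this, of ?UI "space (P \<theta>)"]
    have "?UI -` ((\<lambda>u. restrict u {1..n}) -` A \<inter> space (PiM {1..} (\<lambda>_. borel))) \<inter> space (P \<theta>)
      \<in> sets (vimage_algebra (space (P \<theta>)) ?UI (PiM {1..} (\<lambda>_. borel)))" .
    also have "?UI -` ((\<lambda>u. restrict u {1..n}) -` A \<inter> space (PiM {1..} (\<lambda>_. borel))) \<inter> space (P \<theta>) = ?UA"
      by (auto simp: space_PiM restrict_restrict Int_absorb1 Int_absorb2 atLeastAtMost_def)
    finally have UA: "?UA \<in> sets (vimage_algebra (space (P \<theta>)) ?UI (PiM {1..} (\<lambda>_. borel)))" .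
    have "(\<lambda>u. restrict u {1..n}) -` B \<inter> space (PiM {1..} (\<lambda>_. \<mu>)) \<in> sets (PiM {1..} (\<lambda>_. \<mu>))"
      by (rule measurable_sets[OF measurable_restrict_subset B[unfolded obs_def]]) auto
    from in_vimage_algebra[OF this, of ?XI "space (P \<theta>)"]
    have "?XI -` ((\<lambda>u. restrict u {1..n}) -` B \<inter> space (PiM {1..} (\<lambda>_. \<mu>))) \<inter> space (P \<theta>)
      \<in> sets (vimage_algebra (space (P \<theta>)) ?XI (PiM {1..} (\<lambda>_. \<mu>)))" .
    also have "?XI -` ((\<lambda>u. restrict u {1..n}) -` B \<inter> space (PiM {1..} (\<lambda>_. \<mu>))) \<inter> space (P \<theta>) = ?XB"
      using measurable_space[OF X_measurable[OF \<theta>]]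
      by (auto simp: space_PiM restrict_restrict Int_absorb1 Int_absorb2 atLeastAtMost_def Xvec_def)
    finally have XB: "?XB \<in> sets (vimage_algebra (space (P \<theta>)) ?XI (PiM {1..} (\<lambda>_. \<mu>)))" .
    have "prob (?UA \<inter> ?XB) = prob ?UA * prob ?XB"
      using U_X_indep[OF \<theta>] UA XB by (rule indep_setD)
    then have "emeasure (P \<theta>) ?UA * emeasure (P \<theta>) ?XB = emeasure (P \<theta>) (?UA \<inter> ?XB)"
      by (simp add: emeasure_eq_measure ennreal_mult)
    also have "?UA \<inter> ?XB = (\<lambda>\<omega>. (?U \<omega>, Xvec X n \<omega>)) -` (A \<times> B) \<inter> space (P \<theta>)"
      by auto
    finally show "emeasure (distr (P \<theta>) ?B ?U) A * emeasure (distr (P \<theta>) (obs \<mu> n) (Xvec X n)) B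
      = emeasure (distr (P \<theta>) (?B \<Otimes>\<^sub>M obs \<mu> n) (\<lambda>\<omega>. (?U \<omega>, Xvec X n \<omega>))) (A \<times> B)"
      by (simp only: emeasure_distr[OF U A] emeasure_distr[OF Xvec_measurable[OF \<theta> n] B]
          emeasure_distr[OF measurable_Pair[OF U Xvec_measurable[OF \<theta> n]] pair_measureI[OF A B]])
  qed simp
  then show ?thesis
    using distr_U[OF \<theta> n] by simp
qed

lemma restrict_Xvec: "m \<le> n \<Longrightarrow> restrict (Xvec X n \<omega>) {1..m} = Xvec X m \<omega>"
  by (auto simp: Xvec_def restrict_def)

section \<open>Probability of stopping at a given stage, and the expected stopping time\<close>

context
  fixes \<psi> assumes \<psi>: "stopping_rule \<mu> \<psi>"
begin

lemma stop_time_set_measurable: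
  assumes \<theta>: "\<theta> \<in> space Th" and n: "1 \<le> n"
  shows "{\<omega> \<in> space (P \<theta>). stop_time X U \<psi> \<omega> = enat n} \<in> sets (P \<theta>)"
proof -
  have [measurable]: "(\<lambda>\<omega>. \<psi> i (Xvec X i \<omega>)) \<in> borel_measurable (P \<theta>)" "U i \<in> borel_measurable (P \<theta>)"
    if "1 \<le> i" for i
    using measurable_compose[OF Xvec_measurable[OF \<theta> that] stopping_rule_measurable[OF \<psi> that]]
      U_measurable[OF \<theta> that] by auto
  show ?thesis
    unfolding stop_time_eq_enat_iff[OF n]
    by (intro sets.sets_Collect_conj sets.sets_Collect_finite_All borel_measurable_less borel_measurable_le)
      (use n in auto)
qed

text \<open>By independence and Fubini the observations may be fixed. For fixed x the event is a box
  in the independent uniform variables, with sides of probability \<open>1 - \<psi> i\<close> for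
  \<open>i < n\<close> and \<open>\<psi> n\<close>; their product is \<open>spsi\<close>.\<close>

lemma emeasure_stop_time_eq:
  assumes \<theta>: "\<theta> \<in> space Th" and n: "1 \<le> n"
  shows "emeasure (P \<theta>) {\<omega> \<in> space (P \<theta>). stop_time X U \<psi> \<omega> = enat n}
    = (\<integral>\<^sup>+\<omega>. ennreal (spsi \<psi> n (Xvec X n \<omega>)) \<partial>P \<theta>)"
proof -
  interpret prob_space "P \<theta>"
    using \<theta> by (rule prob)
  let ?Un = "uniform_measure lborel {0..1::real}"
  let ?UU = "PiM {1..n} (\<lambda>_. ?Un)" and ?XX = "distr (P \<theta>) (obs \<mu> n) (Xvec X n)"
  let ?B = "PiM {1..n} (\<lambda>_. borel :: real measure)"
  have prob_Un: "prob_space ?Un"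
    by (rule prob_space_uniform_measure) auto
  interpret Un: prob_space ?Un
    by (rule prob_Un)
  interpret UU: product_prob_space "\<lambda>_::nat. ?Un" "{1..n}" ..
  note [measurable] = Xvec_measurable[OF \<theta> n]
  interpret XX: prob_space ?XX
    by (rule prob_space_distr) simp
  interpret pair_sigma_finite ?UU ?XX ..
  \<comment> \<open>\<open>J i x\<close> is the i-th side of this box, and \<open>E\<close> below is
    the event as a subset of the joint space.\<close>
  define J where "J i x = (if i < n then {\<psi> i (restrict x {1..i})<..} else {..\<psi> n x})" for i x
  define E where "E = {z \<in> space (?B \<Otimes>\<^sub>M obs \<mu> n).
    (\<forall>i\<in>{1..<n}. \<psi> i (restrict (snd z) {1..i}) < fst z i) \<and> fst z n \<le> \<psi> n (snd z)}"
  have E: "E \<in> sets (?B \<Otimes>\<^sub>M obs \<mu> n)"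
    unfolding E_def
  proof (intro sets.sets_Collect_conj sets.sets_Collect_finite_All borel_measurable_less borel_measurable_le)
    have U: "(\<lambda>z. fst z i) \<in> borel_measurable (?B \<Otimes>\<^sub>M obs \<mu> n)" if "i \<in> {1..n}" for i
      using that by (intro measurable_compose[OF measurable_fst measurable_component_singleton])
    show "(\<lambda>z. fst z n) \<in> borel_measurable (?B \<Otimes>\<^sub>M obs \<mu> n)"
      using n by (intro U) auto
    show "(\<lambda>z. \<psi> n (snd z)) \<in> borel_measurable (?B \<Otimes>\<^sub>M obs \<mu> n)"
      by (rule measurable_compose[OF measurable_snd stopping_rule_measurable[OF \<psi> n]])
    fix i assume i: "i \<in> {1..<n}"
    then show "(\<lambda>z. fst z i) \<in> borel_measurable (?B \<Otimes>\<^sub>M obs \<mu> n)"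
      by (intro U) auto
    from i show "(\<lambda>z. \<psi> i (restrict (snd z) {1..i})) \<in> borel_measurable (?B \<Otimes>\<^sub>M obs \<mu> n)"
      by (intro measurable_compose[OF measurable_snd
            measurable_compose[OF measurable_restrict_obs stopping_rule_measurable[OF \<psi>]]]) auto
  qed auto
  have sets_UU: "sets (?UU \<Otimes>\<^sub>M ?XX) = sets (?B \<Otimes>\<^sub>M obs \<mu> n)"
    by (intro sets_pair_measure_cong sets_PiM_cong) auto
  have "{\<omega> \<in> space (P \<theta>). stop_time X U \<psi> \<omega> = enat n}
    = (\<lambda>\<omega>. (\<lambda>i\<in>{1..n}. U i \<omega>, Xvec X n \<omega>)) -` E \<inter> space (P \<theta>)"
    using n measurable_space[OF Xvec_measurable[OF \<theta> n]]
    by (auto simp: stop_time_eq_enat_iff E_def space_pair_measure space_PiM restrict_Xvec[simplified])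
  moreover have "(\<lambda>\<omega>. (\<lambda>i\<in>{1..n}. U i \<omega>, Xvec X n \<omega>)) \<in> measurable (P \<theta>) (?B \<Otimes>\<^sub>M obs \<mu> n)"
    using \<theta> by (intro measurable_Pair measurable_restrict U_measurable) auto
  ultimately have "emeasure (P \<theta>) {\<omega> \<in> space (P \<theta>). stop_time X U \<psi> \<omega> = enat n}
    = emeasure (?UU \<Otimes>\<^sub>M ?XX) E"
    unfolding distr_U_Xvec[OF \<theta> n, symmetric] by (simp only: emeasure_distr[OF _ E])
  also have "\<dots> = (\<integral>\<^sup>+x. emeasure ?UU ((\<lambda>u. (u, x)) -` E) \<partial>?XX)"
    by (rule emeasure_pair_measure_alt2) (simp only: sets_UU E)
  also have "\<dots> = (\<integral>\<^sup>+x. ennreal (spsi \<psi> n x) \<partial>?XX)"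
  proof (rule nn_integral_cong)
    fix x assume "x \<in> space ?XX"
    then have x: "x \<in> space (obs \<mu> n)"
      by simp
    have bounds: "0 \<le> \<psi> i (restrict x {1..i})" "\<psi> i (restrict x {1..i}) \<le> 1" if "1 \<le> i" "i \<le> n" for i
      using stopping_rule_bounds[OF \<psi> that(1) restrict_obs_space[OF x that(2)]] by auto
    have ball: "(\<forall>i\<in>{1..n}. R i) \<longleftrightarrow> (\<forall>i\<in>{1..<n}. R i) \<and> R n" for R
      using n by (auto simp: le_less)
    have "(u, x) \<in> E \<longleftrightarrow> u \<in> PiE {1..n} (\<lambda>i. J i x)" for u
      unfolding PiE_iff ball by (simp add: E_def J_def space_pair_measure space_PiM PiE_iff x conj_ac)
    then have "(\<lambda>u. (u, x)) -` E = PiE {1..n} (\<lambda>i. J i x)"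
      by auto
    then have "emeasure ?UU ((\<lambda>u. (u, x)) -` E) = (\<Prod>i\<in>{1..n}. emeasure ?Un (J i x))"
      by (simp only:, subst UU.emeasure_PiM) (auto simp: J_def)
    also have "\<dots> = emeasure ?Un (J n x) * (\<Prod>i\<in>{1..<n}. emeasure ?Un (J i x))"
      using n by (simp only: atLeastLessThanSuc_atLeastAtMost[symmetric] prod.atLeastLessThan_Suc mult.commute)
    also have "emeasure ?Un (J n x) = ennreal (\<psi> n x)"
      using stopping_rule_bounds[OF \<psi> n x] by (simp only: J_def less_irrefl if_False emeasure_uniform_atMost)
    also have "(\<Prod>i\<in>{1..<n}. emeasure ?Un (J i x)) = (\<Prod>i\<in>{1..<n}. ennreal (1 - \<psi> i (restrict x {1..i})))"
      using bounds by (intro prod.cong refl) (simp add: J_def emeasure_uniform_greaterThan del: emeasure_uniform_measure)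
    also have "ennreal (\<psi> n x) * (\<Prod>i\<in>{1..<n}. ennreal (1 - \<psi> i (restrict x {1..i})))
      = ennreal (\<psi> n x) * ennreal (tpsi \<psi> n x)"
      unfolding tpsi_def by (subst prod_ennreal) (use bounds in auto)
    also have "\<dots> = ennreal (spsi \<psi> n x)"
      using x n by (simp add: ennreal_spsi[OF \<psi>] mult.commute)
    finally show "emeasure ?UU ((\<lambda>u. (u, x)) -` E) = ennreal (spsi \<psi> n x)" .
  qed
  also have "\<dots> = (\<integral>\<^sup>+\<omega>. ennreal (spsi \<psi> n (Xvec X n \<omega>)) \<partial>P \<theta>)"
    using spsi_measurable[OF \<psi> n] by (subst nn_integral_distr) auto
  finally show ?thesis .
qed

lemma sum_emeasure_stop_time:
  assumes \<theta>: "\<theta> \<in> space Th"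
  shows "(\<Sum>n. emeasure (P \<theta>) {\<omega> \<in> space (P \<theta>). stop_time X U \<psi> \<omega> = enat (Suc n)})
    = emeasure (P \<theta>) {\<omega> \<in> space (P \<theta>). stop_time X U \<psi> \<omega> \<noteq> \<infinity>}"
proof -
  have "(\<Sum>n. emeasure (P \<theta>) {\<omega> \<in> space (P \<theta>). stop_time X U \<psi> \<omega> = enat (Suc n)})
    = emeasure (P \<theta>) (\<Union>n. {\<omega> \<in> space (P \<theta>). stop_time X U \<psi> \<omega> = enat (Suc n)})"
    using stop_time_set_measurable[OF \<theta>] by (intro suminf_emeasure) (auto simp: disjoint_family_on_def)
  also have "(\<Union>n. {\<omega> \<in> space (P \<theta>). stop_time X U \<psi> \<omega> = enat (Suc n)})
    = {\<omega> \<in> space (P \<theta>). stop_time X U \<psi> \<omega> \<noteq> \<infinity>}"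
    using stop_time_eq_infinity_iff[of X U \<psi>] by auto
  finally show ?thesis .
qed

text \<open>The probabilities of the finite values add up to at most 1, so the condition
  \<open>< 1\<close> in the definition says that the sum is not 1. If it is 1, the stopping time is
  almost surely finite and its expectation is the usual series.\<close>

lemma E_stop_time_eq:
  assumes \<theta>: "\<theta> \<in> space Th"
  defines "p n \<equiv> emeasure (P \<theta>) {\<omega> \<in> space (P \<theta>). stop_time X U \<psi> \<omega> = enat (Suc n)}"
  shows "E_stop_time (P \<theta>) X U \<psi> = (if (\<Sum>n. p n) = 1 then \<Sum>n. of_nat (Suc n) * p n else \<infinity>)"
proof -
  interpret prob_space "P \<theta>"
    using \<theta> by (rule prob)
  let ?A = "\<lambda>n. {\<omega> \<in> space (P \<theta>). stop_time X U \<psi> \<omega> = enat (Suc n)}"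
  have [measurable]: "?A n \<in> sets (P \<theta>)" for n
    using stop_time_set_measurable[OF \<theta>] by simp
  have le: "(\<Sum>n. p n) \<le> 1"
    unfolding p_def sum_emeasure_stop_time[OF \<theta>] by (rule emeasure_le_1)
  have "(\<integral>\<^sup>+\<omega>. ennreal_of_enat (stop_time X U \<psi> \<omega>) \<partial>P \<theta>) = (\<Sum>n. of_nat (Suc n) * p n)"
    if 1: "(\<Sum>n. p n) = 1"
  proof -
    have fin_set: "{\<omega> \<in> space (P \<theta>). stop_time X U \<psi> \<omega> \<noteq> \<infinity>} = (\<Union>n. ?A n)"
      using stop_time_eq_infinity_iff[of X U \<psi>] by auto
    have "emeasure (P \<theta>) (\<Union>n. ?A n) = 1"
      using 1 unfolding p_def sum_emeasure_stop_time[OF \<theta>] fin_set .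
    then have "AE \<omega> in P \<theta>. \<omega> \<in> (\<Union>n. ?A n)"
      by (intro prob_eq_1[THEN iffD1]) (auto simp: measure_def)
    then have "(\<integral>\<^sup>+\<omega>. ennreal_of_enat (stop_time X U \<psi> \<omega>) \<partial>P \<theta>)
      = (\<integral>\<^sup>+\<omega>. (\<Sum>n. of_nat (Suc n) * indicator (?A n) \<omega>) \<partial>P \<theta>)"
    proof (intro nn_integral_cong_AE, eventually_elim)
      case (elim \<omega>)
      then obtain m where m: "\<omega> \<in> ?A m"
        by auto
      then have "(\<Sum>n. of_nat (Suc n) * indicator (?A n) \<omega> :: ennreal)
        = (\<Sum>n\<in>{m}. of_nat (Suc n) * indicator (?A n) \<omega>)"
        by (intro suminf_finite) auto
      with m show ?case
        by simp
    qed
    also have "\<dots> = (\<Sum>n. of_nat (Suc n) * p n)"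
      by (subst nn_integral_suminf) (auto simp: nn_integral_cmult p_def simp del: of_nat_Suc)
    finally show ?thesis .
  qed
  moreover have "(\<Sum>n. p n) < 1 \<longleftrightarrow> (\<Sum>n. p n) \<noteq> 1"
    using le by auto
  ultimately show ?thesis
    unfolding E_stop_time_def p_def[symmetric] by auto
qed

end

section \<open>Risks as integrals of mixture densities\<close>

text \<open>Tonelli for the prior and the observations. \<open>G\<close> may depend on \<theta>, as
  the losses do.\<close>

lemma nn_integral_Xvec_prior:
  assumes \<pi>: "prob_space \<pi>" "sets \<pi> = sets Th" and n: "1 \<le> n"
    and G [measurable]: "(\<lambda>(\<theta>, x). G \<theta> x) \<in> borel_measurable (Th \<Otimes>\<^sub>M obs \<mu> n)"
  shows "(\<lambda>\<theta>. \<integral>\<^sup>+x. ennreal (f n \<theta> x) * G \<theta> x \<partial>obs \<mu> n) \<in> borel_measurable Th"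
    and "(\<lambda>x. \<integral>\<^sup>+\<theta>. ennreal (f n \<theta> x) * G \<theta> x \<partial>\<pi>) \<in> borel_measurable (obs \<mu> n)"
    and "(\<integral>\<^sup>+\<theta>. (\<integral>\<^sup>+\<omega>. G \<theta> (Xvec X n \<omega>) \<partial>P \<theta>) \<partial>\<pi>)
      = (\<integral>\<^sup>+x. (\<integral>\<^sup>+\<theta>. ennreal (f n \<theta> x) * G \<theta> x \<partial>\<pi>) \<partial>obs \<mu> n)"
proof -
  interpret \<pi>: prob_space \<pi>
    by (rule \<pi>)
  interpret obs: sigma_finite_measure "obs \<mu> n"
    by (rule sigma_finite_obs)
  interpret pair_sigma_finite \<pi> "obs \<mu> n" ..
  have sp: "space \<pi> = space Th"
    using \<pi>(2) by (rule sets_eq_imp_space_eq)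
  note f_measurable[OF n, measurable]
  have H: "(\<lambda>(\<theta>, x). ennreal (f n \<theta> x) * G \<theta> x) \<in> borel_measurable (Th \<Otimes>\<^sub>M obs \<mu> n)"
    by measurable
  then have H\<pi>: "(\<lambda>(\<theta>, x). ennreal (f n \<theta> x) * G \<theta> x) \<in> borel_measurable (\<pi> \<Otimes>\<^sub>M obs \<mu> n)"
    using sets_pair_measure_cong[OF \<pi>(2) refl] measurable_cong_sets[OF _ refl] by blast
  show "(\<lambda>\<theta>. \<integral>\<^sup>+x. ennreal (f n \<theta> x) * G \<theta> x \<partial>obs \<mu> n) \<in> borel_measurable Th"
    by (rule obs.borel_measurable_nn_integral[OF H])
  show "(\<lambda>x. \<integral>\<^sup>+\<theta>. ennreal (f n \<theta> x) * G \<theta> x \<partial>\<pi>) \<in> borel_measurable (obs \<mu> n)"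
    using measurable_pair_swap[OF H\<pi>] by (intro \<pi>.borel_measurable_nn_integral) (simp add: split_beta')
  have "(\<integral>\<^sup>+\<theta>. (\<integral>\<^sup>+\<omega>. G \<theta> (Xvec X n \<omega>) \<partial>P \<theta>) \<partial>\<pi>)
    = (\<integral>\<^sup>+\<theta>. (\<integral>\<^sup>+x. ennreal (f n \<theta> x) * G \<theta> x \<partial>obs \<mu> n) \<partial>\<pi>)"
  proof (rule nn_integral_cong)
    fix \<theta> assume "\<theta> \<in> space \<pi>"
    then have \<theta>: "\<theta> \<in> space Th"
      by (simp add: sp)
    have "G \<theta> \<in> borel_measurable (obs \<mu> n)"
      using measurable_compose[OF measurable_Pair1'[OF \<theta>] G] by simp
    then show "(\<integral>\<^sup>+\<omega>. G \<theta> (Xvec X n \<omega>) \<partial>P \<theta>) = (\<integral>\<^sup>+x. ennreal (f n \<theta> x) * G \<theta> x \<partial>obs \<mu> n)"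
      by (rule nn_integral_Xvec[OF \<theta> n])
  qed
  also have "\<dots> = (\<integral>\<^sup>+x. (\<integral>\<^sup>+\<theta>. ennreal (f n \<theta> x) * G \<theta> x \<partial>\<pi>) \<partial>obs \<mu> n)"
    using Fubini'[OF H\<pi>] by simp
  finally show "(\<integral>\<^sup>+\<theta>. (\<integral>\<^sup>+\<omega>. G \<theta> (Xvec X n \<omega>) \<partial>P \<theta>) \<partial>\<pi>)
    = (\<integral>\<^sup>+x. (\<integral>\<^sup>+\<theta>. ennreal (f n \<theta> x) * G \<theta> x \<partial>\<pi>) \<partial>obs \<mu> n)" .
qed

lemma f_section_measurable:
  assumes "sets \<pi> = sets Th" "1 \<le> n" "x \<in> space (obs \<mu> n)"
  shows "(\<lambda>\<theta>. f n \<theta> x) \<in> borel_measurable \<pi>"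
  using measurable_compose[OF measurable_Pair2'[OF assms(3)] f_measurable[OF assms(2)]]
    measurable_cong_sets[OF assms(1) refl] by auto

lemma nn_integral_Xvec_mix:
  assumes \<pi>: "prob_space \<pi>" "sets \<pi> = sets Th" and n: "1 \<le> n"
    and g: "g \<in> borel_measurable (obs \<mu> n)"
  shows "(\<integral>\<^sup>+\<theta>. (\<integral>\<^sup>+\<omega>. g (Xvec X n \<omega>) \<partial>P \<theta>) \<partial>\<pi>) = (\<integral>\<^sup>+x. g x * mix_density \<pi> f n x \<partial>obs \<mu> n)"
proof -
  have "(\<integral>\<^sup>+\<theta>. (\<integral>\<^sup>+\<omega>. g (Xvec X n \<omega>) \<partial>P \<theta>) \<partial>\<pi>)
    = (\<integral>\<^sup>+x. (\<integral>\<^sup>+\<theta>. ennreal (f n \<theta> x) * g x \<partial>\<pi>) \<partial>obs \<mu> n)"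
    by (rule nn_integral_Xvec_prior(3)[OF \<pi> n]) (use g in measurable)
  also have "\<dots> = (\<integral>\<^sup>+x. g x * mix_density \<pi> f n x \<partial>obs \<mu> n)"
  proof (rule nn_integral_cong)
    fix x assume "x \<in> space (obs \<mu> n)"
    from f_section_measurable[OF \<pi>(2) n this]
    show "(\<integral>\<^sup>+\<theta>. ennreal (f n \<theta> x) * g x \<partial>\<pi>) = g x * mix_density \<pi> f n x"
      by (simp add: mix_density_def nn_integral_cmult mult.commute)
  qed
  finally show ?thesis .
qed

lemma mix_density_measurable:
  assumes "prob_space \<pi>" "sets \<pi> = sets Th" "1 \<le> n"
  shows "mix_density \<pi> f n \<in> borel_measurable (obs \<mu> n)"
  using nn_integral_Xvec_prior(2)[OF assms, of "\<lambda>_ _. 1"] by (simp add: mix_density_def[abs_def])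

text \<open>Both sides are the prior average of the expectation of \<open>g (Xvec X n)\<close>,
  computed once from the density at stage n + 1 and once from that at stage n.\<close>

lemma mix_density_consistent:
  assumes \<pi>: "prob_space \<pi>" "sets \<pi> = sets Th" and n: "1 \<le> n" and g: "g \<in> borel_measurable (obs \<mu> n)"
  shows "(\<integral>\<^sup>+x. g (restrict x {1..n}) * mix_density \<pi> f (Suc n) x \<partial>obs \<mu> (Suc n))
    = (\<integral>\<^sup>+x. g x * mix_density \<pi> f n x \<partial>obs \<mu> n)"
proof -
  have "(\<lambda>x. g (restrict x {1..n})) \<in> borel_measurable (obs \<mu> (Suc n))"
    by (rule measurable_compose[OF measurable_restrict_obs g]) simp
  from nn_integral_Xvec_mix[OF \<pi> _ this]
  have "(\<integral>\<^sup>+x. g (restrict x {1..n}) * mix_density \<pi> f (Suc n) x \<partial>obs \<mu> (Suc n))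
    = (\<integral>\<^sup>+\<theta>. (\<integral>\<^sup>+\<omega>. g (restrict (Xvec X (Suc n) \<omega>) {1..n}) \<partial>P \<theta>) \<partial>\<pi>)"
    by simp
  then show ?thesis
    by (simp only: restrict_Xvec[OF le_SucI[OF order_refl]] nn_integral_Xvec_mix[OF \<pi> n g])
qed

lemma mix_density_total:
  assumes \<pi>: "prob_space \<pi>" "sets \<pi> = sets Th"
  shows "(\<integral>\<^sup>+x. mix_density \<pi> f 1 x \<partial>obs \<mu> 1) = 1"
proof -
  interpret \<pi>: prob_space \<pi>
    by (rule \<pi>)
  have "(\<integral>\<^sup>+x. mix_density \<pi> f 1 x \<partial>obs \<mu> 1) = (\<integral>\<^sup>+\<theta>. (\<integral>\<^sup>+\<omega>. 1 \<partial>P \<theta>) \<partial>\<pi>)"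
    using nn_integral_Xvec_mix[OF \<pi>, of 1 "\<lambda>_. 1"] by simp
  also have "\<dots> = (\<integral>\<^sup>+\<theta>. 1 \<partial>\<pi>)"
    using prob_space.emeasure_space_1[OF prob] sets_eq_imp_space_eq[OF \<pi>(2)]
    by (intro nn_integral_cong) simp
  finally show ?thesis
    by (simp add: \<pi>.emeasure_space_1)
qed

section \<open>The average sample number as a series\<close>

context
  fixes \<psi> assumes \<psi>: "stopping_rule \<mu> \<psi>"
begin

lemma prob_stop_eq:
  assumes \<pi>: "prob_space \<pi>" "sets \<pi> = sets Th"
  shows "prob_stop P X \<pi> \<psi> = (\<Sum>n. \<integral>\<^sup>+x. ennreal (spsi \<psi> (Suc n) x) * mix_density \<pi> f (Suc n) x \<partial>obs \<mu> (Suc n))"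
  unfolding prob_stop_def using spsi_measurable[OF \<psi>]
  by (intro suminf_cong nn_integral_Xvec_mix[OF \<pi>]) auto

text \<open>For each \<theta> the stopping probability is at most 1, so its prior average is 1
  exactly when it is 1 for almost all \<theta>. Otherwise the convention makes
  \<open>E_stop_time\<close> infinite on a set that is not null for the prior.\<close>

lemma ASN_eq:
  assumes \<pi>: "prob_space \<pi>" "sets \<pi> = sets Th"
  shows "ASN P X U \<pi> \<psi> = (if prob_stop P X \<pi> \<psi> = 1
    then \<Sum>n. of_nat (Suc n) * (\<integral>\<^sup>+x. ennreal (spsi \<psi> (Suc n) x) * mix_density \<pi> f (Suc n) x \<partial>obs \<mu> (Suc n))
    else \<infinity>)"
proof -
  interpret \<pi>: prob_space \<pi>
    by (rule \<pi>)
  \<comment> \<open>Written over the observation space, the probability of stopping at stage n + 1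
    is measurable in \<theta> by Tonelli; the model states no measurability of \<open>P\<close> in
    \<theta>.\<close>
  define p where "p n \<theta> = (\<integral>\<^sup>+x. ennreal (f (Suc n) \<theta> x) * ennreal (spsi \<psi> (Suc n) x) \<partial>obs \<mu> (Suc n))" for n \<theta>
  have sp: "space \<pi> = space Th"
    using \<pi>(2) by (rule sets_eq_imp_space_eq)
  have sm [measurable]: "spsi \<psi> (Suc n) \<in> borel_measurable (obs \<mu> (Suc n))" for n
    by (rule spsi_measurable[OF \<psi>]) simp
  have p_measurable [measurable]: "p n \<in> borel_measurable \<pi>" for n
    unfolding p_def[abs_def] measurable_cong_sets[OF \<pi>(2) refl]
    by (rule nn_integral_Xvec_prior(1)[OF \<pi>]) (auto, measurable)
  have p: "p n \<theta> = (\<integral>\<^sup>+\<omega>. ennreal (spsi \<psi> (Suc n) (Xvec X (Suc n) \<omega>)) \<partial>P \<theta>)"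
    "p n \<theta> = emeasure (P \<theta>) {\<omega> \<in> space (P \<theta>). stop_time X U \<psi> \<omega> = enat (Suc n)}" if "\<theta> \<in> space \<pi>" for n \<theta>
    using that nn_integral_Xvec[of \<theta> "Suc n" "\<lambda>x. ennreal (spsi \<psi> (Suc n) x)"] unfolding sp p_def
    by (simp_all add: emeasure_stop_time_eq[OF \<psi>])
  have p_int: "(\<integral>\<^sup>+\<theta>. p n \<theta> \<partial>\<pi>)
    = (\<integral>\<^sup>+x. ennreal (spsi \<psi> (Suc n) x) * mix_density \<pi> f (Suc n) x \<partial>obs \<mu> (Suc n))" for n
    using nn_integral_Xvec_mix[OF \<pi>, of "Suc n" "\<lambda>x. ennreal (spsi \<psi> (Suc n) x)"]
    by (simp add: p(1) cong: nn_integral_cong)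
  have prob_stop: "prob_stop P X \<pi> \<psi> = (\<integral>\<^sup>+\<theta>. (\<Sum>n. p n \<theta>) \<partial>\<pi>)"
    unfolding prob_stop_eq[OF \<pi>] by (subst nn_integral_suminf) (auto simp: p_int)
  have le1: "(\<Sum>n. p n \<theta>) \<le> 1" if "\<theta> \<in> space \<pi>" for \<theta>
  proof -
    interpret prob_space "P \<theta>"
      using that by (rule_tac prob) (simp add: sp)
    show ?thesis
      using that unfolding p(2)[OF that] by (subst sum_emeasure_stop_time[OF \<psi>]) (auto simp: sp emeasure_le_1)
  qed
  have ASN: "ASN P X U \<pi> \<psi> = (\<integral>\<^sup>+\<theta>. (if (\<Sum>n. p n \<theta>) = 1 then \<Sum>n. of_nat (Suc n) * p n \<theta> else \<infinity>) \<partial>\<pi>)"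
    unfolding ASN_def by (intro nn_integral_cong) (simp add: E_stop_time_eq[OF \<psi>] p(2) sp)
  have one_iff: "prob_stop P X \<pi> \<psi> = 1 \<longleftrightarrow> (AE \<theta> in \<pi>. (\<Sum>n. p n \<theta>) = 1)"
  proof
    assume "prob_stop P X \<pi> \<psi> = 1"
    then show "AE \<theta> in \<pi>. (\<Sum>n. p n \<theta>) = 1"
      unfolding prob_stop using le1
      by (intro nn_integral_eq_imp_AE_eq[of _ \<pi> "\<lambda>_. 1"]) (auto simp: \<pi>.emeasure_space_1)
  next
    assume "AE \<theta> in \<pi>. (\<Sum>n. p n \<theta>) = 1"
    then have "(\<integral>\<^sup>+\<theta>. (\<Sum>n. p n \<theta>) \<partial>\<pi>) = (\<integral>\<^sup>+\<theta>. 1 \<partial>\<pi>)"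
      by (rule nn_integral_cong_AE)
    then show "prob_stop P X \<pi> \<psi> = 1"
      by (simp add: prob_stop \<pi>.emeasure_space_1)
  qed
  show ?thesis
  proof (cases "prob_stop P X \<pi> \<psi> = 1")
    case True
    then have "AE \<theta> in \<pi>. (\<Sum>n. p n \<theta>) = 1"
      by (simp add: one_iff)
    then have "ASN P X U \<pi> \<psi> = (\<integral>\<^sup>+\<theta>. (\<Sum>n. of_nat (Suc n) * p n \<theta>) \<partial>\<pi>)"
      unfolding ASN by (intro nn_integral_cong_AE, eventually_elim) simp
    also have "\<dots> = (\<Sum>n. of_nat (Suc n) * (\<integral>\<^sup>+\<theta>. p n \<theta> \<partial>\<pi>))"
      by (subst nn_integral_suminf) (auto simp: nn_integral_cmult simp del: of_nat_Suc)
    finally show ?thesis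
      using True by (simp only: p_int if_True simp_thms)
  next
    case False
    have "ASN P X U \<pi> \<psi> = \<infinity>"
    proof (rule ccontr)
      assume "ASN P X U \<pi> \<psi> \<noteq> \<infinity>"
      then have "AE \<theta> in \<pi>. (if (\<Sum>n. p n \<theta>) = 1 then \<Sum>n. of_nat (Suc n) * p n \<theta> else \<infinity>) \<noteq> \<infinity>"
        unfolding ASN by (intro nn_integral_PInf_AE) (auto intro!: borel_measurable_suminf)
      then have "AE \<theta> in \<pi>. (\<Sum>n. p n \<theta>) = 1"
        by eventually_elim (auto split: if_splits)
      with False show False
        by (simp add: one_iff)
    qed
    with False show ?thesis
      by simp
  qed
qed

end

section \<open>Losses and risks as integrals over the observation space\<close>

lemma wloss_measurable:
  fixes w :: "'t \<Rightarrow> 'd \<Rightarrow> real"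
  assumes w: "(\<lambda>(\<theta>, d). w \<theta> d) \<in> borel_measurable (Th \<Otimes>\<^sub>M D)"
    and \<pi>: "prob_space \<pi>" "sets \<pi> = sets Th"
    and A: "\<And>i. i \<in> {1..k} \<Longrightarrow> A i \<in> sets Th"
    and \<delta>: "decision_rule \<mu> D \<delta>" and n: "1 \<le> n"
  shows "(\<lambda>x. wloss k lam A \<pi> w f n (\<delta> n x) x) \<in> borel_measurable (obs \<mu> n)"
proof -
  interpret \<pi>: prob_space \<pi>
    by (rule \<pi>)
  have [measurable]: "\<delta> n \<in> measurable (obs \<mu> n) D"
    using \<delta> n by (simp add: decision_rule_def)
  have wd: "(\<lambda>(x, \<theta>). w \<theta> (\<delta> n x)) \<in> borel_measurable (obs \<mu> n \<Otimes>\<^sub>M Th)"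
    using measurable_compose[OF _ w, of "\<lambda>(x, \<theta>). (\<theta>, \<delta> n x)" "obs \<mu> n \<Otimes>\<^sub>M Th"] by (simp add: split_beta')
  have f: "(\<lambda>(x, \<theta>). f n \<theta> x) \<in> borel_measurable (obs \<mu> n \<Otimes>\<^sub>M Th)"
    using measurable_pair_swap[OF f_measurable[OF n]] by (simp add: split_beta')
  show ?thesis
    unfolding wloss_def
  proof (intro borel_measurable_sum borel_measurable_times_ennreal borel_measurable_const \<pi>.borel_measurable_nn_integral)
    fix i assume "i \<in> {1..k}"
    note [measurable] = A[OF this] wd f
    have "(\<lambda>(x, \<theta>). ennreal (w \<theta> (\<delta> n x) * f n \<theta> x) * indicator (A i) \<theta>) \<in> borel_measurable (obs \<mu> n \<Otimes>\<^sub>M Th)"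
      by measurable
    then show "(\<lambda>(x, \<theta>). ennreal (w \<theta> (\<delta> n x) * f n \<theta> x) * indicator (A i) \<theta>) \<in> borel_measurable (obs \<mu> n \<Otimes>\<^sub>M \<pi>)"
      using measurable_cong_sets[OF sets_pair_measure_cong[OF refl \<pi>(2)] refl] by blast
  qed
qed

text \<open>Tonelli moves the prior integral of each loss inside the integral over the observations;
  the finite weighted sum then commutes with the series and the integral.\<close>

lemma sum_Wloss_eq:
  fixes w :: "'t \<Rightarrow> 'd \<Rightarrow> real"
  assumes w: "(\<lambda>(\<theta>, d). w \<theta> d) \<in> borel_measurable (Th \<Otimes>\<^sub>M D)"
    and w_nonneg: "\<And>\<theta> d. \<theta> \<in> space Th \<Longrightarrow> d \<in> space D \<Longrightarrow> 0 \<le> w \<theta> d"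
    and \<pi>: "prob_space \<pi>" "sets \<pi> = sets Th"
    and A: "\<And>i. i \<in> {1..k} \<Longrightarrow> A i \<in> sets Th"
    and \<psi>: "stopping_rule \<mu> \<psi>" and \<delta>: "decision_rule \<mu> D \<delta>"
  shows "(\<Sum>i=1..k. ennreal (lam i) * Wloss P X \<pi> w (A i) \<psi> \<delta>)
    = (\<Sum>n. \<integral>\<^sup>+x. ennreal (spsi \<psi> (Suc n) x) * wloss k lam A \<pi> w f (Suc n) (\<delta> (Suc n) x) x \<partial>obs \<mu> (Suc n))"
proof -
  define J where "J i n x = (\<integral>\<^sup>+\<theta>\<in>A i. ennreal (w \<theta> (\<delta> n x) * f n \<theta> x) \<partial>\<pi>)" for i n x
  have sp: "space \<pi> = space Th"
    using \<pi>(2) by (rule sets_eq_imp_space_eq)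
  have J: "J i n \<in> borel_measurable (obs \<mu> n)" 
    "(\<integral>\<^sup>+\<theta>\<in>A i. (\<integral>\<^sup>+\<omega>. ennreal (spsi \<psi> n (Xvec X n \<omega>) * w \<theta> (\<delta> n (Xvec X n \<omega>))) \<partial>P \<theta>) \<partial>\<pi>)
      = (\<integral>\<^sup>+x. ennreal (spsi \<psi> n x) * J i n x \<partial>obs \<mu> n)" if i: "i \<in> {1..k}" and n: "1 \<le> n" for i n
  proof -
    note [measurable] = A[OF i] spsi_measurable[OF \<psi> n] f_measurable[OF n]
    have \<delta>n [measurable]: "\<delta> n \<in> measurable (obs \<mu> n) D"
      using \<delta> n by (simp add: decision_rule_def)
    have wd [measurable]: "(\<lambda>(\<theta>, x). w \<theta> (\<delta> n x)) \<in> borel_measurable (Th \<Otimes>\<^sub>M obs \<mu> n)"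
      using measurable_compose[OF _ w, of "\<lambda>(\<theta>, x). (\<theta>, \<delta> n x)" "Th \<Otimes>\<^sub>M obs \<mu> n"] by (simp add: split_beta')
    \<comment> \<open>Splitting the products in \<open>ennreal\<close> requires nonnegative real
      factors, which \<open>w\<close> and \<open>f\<close> are known to have on the respective
      spaces.\<close>
    have wf: "ennreal (f n \<theta> x) * (ennreal (spsi \<psi> n x * w \<theta> (\<delta> n x)) * indicator (A i) \<theta>)
      = ennreal (spsi \<psi> n x) * (ennreal (w \<theta> (\<delta> n x) * f n \<theta> x) * indicator (A i) \<theta>)"
      if "\<theta> \<in> space Th" "x \<in> space (obs \<mu> n)" for \<theta> x
      using that spsi_nonneg[OF \<psi> n, of x] w_nonneg[OF that(1) measurable_space[OF \<delta>n that(2)]] f_nonneg[OF n that]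
      by (simp add: ennreal_mult mult_ac)
    have wf1: "ennreal (f n \<theta> x) * (ennreal (w \<theta> (\<delta> n x)) * indicator (A i) \<theta>)
      = ennreal (w \<theta> (\<delta> n x) * f n \<theta> x) * indicator (A i) \<theta>"
      if "\<theta> \<in> space Th" "x \<in> space (obs \<mu> n)" for \<theta> x
      using that w_nonneg[OF that(1) measurable_space[OF \<delta>n that(2)]] f_nonneg[OF n that]
      by (simp add: ennreal_mult mult_ac)
    have "(\<lambda>x. \<integral>\<^sup>+\<theta>. ennreal (f n \<theta> x) * (ennreal (w \<theta> (\<delta> n x)) * indicator (A i) \<theta>) \<partial>\<pi>) \<in> borel_measurable (obs \<mu> n)"
      by (rule nn_integral_Xvec_prior(2)[OF \<pi> n]) measurable
    also have "?this \<longleftrightarrow> J i n \<in> borel_measurable (obs \<mu> n)"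
      unfolding J_def[abs_def] by (intro measurable_cong nn_integral_cong) (simp add: wf1 sp)
    finally show "J i n \<in> borel_measurable (obs \<mu> n)" .
    \<comment> \<open>The restriction to \<open>A i\<close> is moved under the inner expectation, to
      become part of the function \<open>G\<close> of \<open>nn_integral_Xvec_prior\<close>.\<close>
    have "(\<integral>\<^sup>+\<theta>\<in>A i. (\<integral>\<^sup>+\<omega>. ennreal (spsi \<psi> n (Xvec X n \<omega>) * w \<theta> (\<delta> n (Xvec X n \<omega>))) \<partial>P \<theta>) \<partial>\<pi>)
      = (\<integral>\<^sup>+\<theta>. (\<integral>\<^sup>+\<omega>. ennreal (spsi \<psi> n (Xvec X n \<omega>) * w \<theta> (\<delta> n (Xvec X n \<omega>))) * indicator (A i) \<theta> \<partial>P \<theta>) \<partial>\<pi>)"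
      by (intro nn_integral_cong) (auto simp: indicator_def)
    also have "\<dots> = (\<integral>\<^sup>+x. (\<integral>\<^sup>+\<theta>. ennreal (f n \<theta> x) * (ennreal (spsi \<psi> n x * w \<theta> (\<delta> n x)) * indicator (A i) \<theta>) \<partial>\<pi>) \<partial>obs \<mu> n)"
      by (rule nn_integral_Xvec_prior(3)[OF \<pi> n]) measurable
    also have "\<dots> = (\<integral>\<^sup>+x. ennreal (spsi \<psi> n x) * J i n x \<partial>obs \<mu> n)"
    proof (rule nn_integral_cong)
      fix x assume x: "x \<in> space (obs \<mu> n)"
      have 1: "(\<lambda>\<theta>. w \<theta> (\<delta> n x)) \<in> borel_measurable \<pi>"
        using measurable_compose[OF measurable_Pair2'[OF x] wd] measurable_cong_sets[OF \<pi>(2) refl] by auto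
      note [measurable] = 1 f_section_measurable[OF \<pi>(2) n x]
      have [measurable]: "A i \<in> sets \<pi>"
        using A[OF i] \<pi>(2) by simp
      have "(\<integral>\<^sup>+\<theta>. ennreal (f n \<theta> x) * (ennreal (spsi \<psi> n x * w \<theta> (\<delta> n x)) * indicator (A i) \<theta>) \<partial>\<pi>)
        = (\<integral>\<^sup>+\<theta>. ennreal (spsi \<psi> n x) * (ennreal (w \<theta> (\<delta> n x) * f n \<theta> x) * indicator (A i) \<theta>) \<partial>\<pi>)"
        using x by (intro nn_integral_cong) (simp only: wf sp)
      also have "\<dots> = ennreal (spsi \<psi> n x) * J i n x"
        unfolding J_def by (rule nn_integral_cmult) measurable
      finally show "(\<integral>\<^sup>+\<theta>. ennreal (f n \<theta> x) * (ennreal (spsi \<psi> n x * w \<theta> (\<delta> n x)) * indicator (A i) \<theta>) \<partial>\<pi>)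
        = ennreal (spsi \<psi> n x) * J i n x" .
    qed
    finally show "(\<integral>\<^sup>+\<theta>\<in>A i. (\<integral>\<^sup>+\<omega>. ennreal (spsi \<psi> n (Xvec X n \<omega>) * w \<theta> (\<delta> n (Xvec X n \<omega>))) \<partial>P \<theta>) \<partial>\<pi>)
      = (\<integral>\<^sup>+x. ennreal (spsi \<psi> n x) * J i n x \<partial>obs \<mu> n)" .
  qed
  have "(\<Sum>i=1..k. ennreal (lam i) * Wloss P X \<pi> w (A i) \<psi> \<delta>)
    = (\<Sum>i=1..k. \<Sum>n. ennreal (lam i) * (\<integral>\<^sup>+x. ennreal (spsi \<psi> (Suc n) x) * J i (Suc n) x \<partial>obs \<mu> (Suc n)))"
    unfolding Wloss_def ennreal_suminf_cmult[symmetric] by (intro sum.cong suminf_cong) (auto simp: J(2))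
  also have "\<dots> = (\<Sum>n. \<Sum>i=1..k. ennreal (lam i) * (\<integral>\<^sup>+x. ennreal (spsi \<psi> (Suc n) x) * J i (Suc n) x \<partial>obs \<mu> (Suc n)))"
    by (rule suminf_sum[symmetric]) (rule summableI)
  also have "\<dots> = (\<Sum>n. \<integral>\<^sup>+x. ennreal (spsi \<psi> (Suc n) x) * wloss k lam A \<pi> w f (Suc n) (\<delta> (Suc n) x) x \<partial>obs \<mu> (Suc n))"
  proof (rule suminf_cong)
    fix n
    note [measurable] = J(1)[of _ "Suc n"] spsi_measurable[OF \<psi>, of "Suc n"]
    have "(\<Sum>i=1..k. ennreal (lam i) * (\<integral>\<^sup>+x. ennreal (spsi \<psi> (Suc n) x) * J i (Suc n) x \<partial>obs \<mu> (Suc n)))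
      = (\<Sum>i=1..k. \<integral>\<^sup>+x. ennreal (lam i) * (ennreal (spsi \<psi> (Suc n) x) * J i (Suc n) x) \<partial>obs \<mu> (Suc n))"
      by (intro sum.cong refl nn_integral_cmult[symmetric]) auto
    also have "\<dots> = (\<integral>\<^sup>+x. (\<Sum>i=1..k. ennreal (lam i) * (ennreal (spsi \<psi> (Suc n) x) * J i (Suc n) x)) \<partial>obs \<mu> (Suc n))"
      by (rule nn_integral_sum[symmetric]) auto
    also have "\<dots> = (\<integral>\<^sup>+x. ennreal (spsi \<psi> (Suc n) x) * wloss k lam A \<pi> w f (Suc n) (\<delta> (Suc n) x) x \<partial>obs \<mu> (Suc n))"
      unfolding wloss_def J_def sum_distrib_left by (intro nn_integral_cong sum.cong refl) (rule mult.left_commute)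
    finally show "(\<Sum>i=1..k. ennreal (lam i) * (\<integral>\<^sup>+x. ennreal (spsi \<psi> (Suc n) x) * J i (Suc n) x \<partial>obs \<mu> (Suc n)))
      = (\<integral>\<^sup>+x. ennreal (spsi \<psi> (Suc n) x) * wloss k lam A \<pi> w f (Suc n) (\<delta> (Suc n) x) x \<partial>obs \<mu> (Suc n))" .
  qed
  finally show ?thesis .
qed

text \<open>Each stage cost splits into sampling cost and loss. If the total stopping probability is
  not 1, both sides are infinite, the right one through the average sample number.\<close>

lemma stopping_risk_eq_ASN_plus_loss:
  assumes sp: "stopping_problem \<mu> (mix_density \<pi> f) l" and \<psi>: "stopping_rule \<mu> \<psi>"
    and \<pi>: "prob_space \<pi>" "sets \<pi> = sets Th"
  shows "stopping_problem.stopping_risk \<mu> (mix_density \<pi> f) l \<psi>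
    = ASN P X U \<pi> \<psi> + (\<Sum>n. \<integral>\<^sup>+x. ennreal (spsi \<psi> (Suc n) x) * l (Suc n) x \<partial>obs \<mu> (Suc n))"
proof -
  interpret stopping_problem \<mu> "mix_density \<pi> f" l
    by (rule sp)
  let ?F = "mix_density \<pi> f"
  have "stop_cost \<mu> ?F l \<psi> (Suc n)
    = of_nat (Suc n) * (\<integral>\<^sup>+x. ennreal (spsi \<psi> (Suc n) x) * ?F (Suc n) x \<partial>obs \<mu> (Suc n))
      + (\<integral>\<^sup>+x. ennreal (spsi \<psi> (Suc n) x) * l (Suc n) x \<partial>obs \<mu> (Suc n))" for n
  proof -
    note [measurable] = measurability[OF \<psi>, of "Suc n", simplified]
    show ?thesis
      unfolding stop_cost_def
      by (subst nn_integral_cmult[symmetric], measurable, subst nn_integral_add[symmetric])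
        (auto simp: distrib_left mult_ac simp del: of_nat_Suc)
  qed
  then have "(\<Sum>n. stop_cost \<mu> ?F l \<psi> (Suc n))
    = (\<Sum>n. of_nat (Suc n) * (\<integral>\<^sup>+x. ennreal (spsi \<psi> (Suc n) x) * ?F (Suc n) x \<partial>obs \<mu> (Suc n)))
      + (\<Sum>n. \<integral>\<^sup>+x. ennreal (spsi \<psi> (Suc n) x) * l (Suc n) x \<partial>obs \<mu> (Suc n))"
    by (simp only: suminf_add[OF summableI summableI])
  then show ?thesis
    unfolding stopping_risk_def ASN_eq[OF \<psi> \<pi>] prob_stop_eq[OF \<psi> \<pi>] by simp
qed

end

section \<open>Optimality under constraints on the losses\<close>

theorem mainTheorem4:
  fixes Th :: "'t measure" and \<mu> :: "'x measure" and D :: "'d measure"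
    and P :: "'t \<Rightarrow> 'o measure" and X :: "nat \<Rightarrow> 'o \<Rightarrow> 'x" and U :: "nat \<Rightarrow> 'o \<Rightarrow> real"
    and f :: "nat \<Rightarrow> 't \<Rightarrow> (nat \<Rightarrow> 'x) \<Rightarrow> real"
    and w :: "'t \<Rightarrow> 'd \<Rightarrow> real" and \<pi>\<^sub>1 \<pi>\<^sub>2 :: "'t measure"
    and k :: nat and Ths :: "nat \<Rightarrow> 't set" and lam :: "nat \<Rightarrow> real"
    and \<delta>B \<delta> :: "nat \<Rightarrow> (nat \<Rightarrow> 'x) \<Rightarrow> 'd" and \<psi> \<psi>' :: "nat \<Rightarrow> (nat \<Rightarrow> 'x) \<Rightarrow> real"
    and l F :: "nat \<Rightarrow> (nat \<Rightarrow> 'x) \<Rightarrow> ennreal"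
  assumes model: "sequential_model Th \<mu> P X U f"
    and w_measurable: "(\<lambda>(\<theta>, d). w \<theta> d) \<in> borel_measurable (Th \<Otimes>\<^sub>M D)"
    and w_nonneg: "\<And>\<theta> d. \<theta> \<in> space Th \<Longrightarrow> d \<in> space D \<Longrightarrow> 0 \<le> w \<theta> d"
    and \<pi>\<^sub>1: "prob_space \<pi>\<^sub>1" "sets \<pi>\<^sub>1 = sets Th"
    and \<pi>\<^sub>2: "prob_space \<pi>\<^sub>2" "sets \<pi>\<^sub>2 = sets Th"
    and Ths_sets: "\<And>i. i \<in> {1..k} \<Longrightarrow> Ths i \<in> sets Th"
    and Ths_disjoint: "disjoint_family_on Ths {1..k}"
    and lam_pos: "\<And>i. i \<in> {1..k} \<Longrightarrow> 0 < lam i"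
    and \<delta>B_rule: "decision_rule \<mu> D \<delta>B"
    and l_eq: "\<And>n x. l n x = wloss k lam Ths \<pi>\<^sub>1 w f n (\<delta>B n x) x"
    and F_eq: "\<And>n x. F n x = mix_density \<pi>\<^sub>2 f n x"
    and \<delta>B_bayes: "\<And>n. 1 \<le> n \<Longrightarrow>
      AE x in obs \<mu> n. \<forall>d\<in>space D. wloss k lam Ths \<pi>\<^sub>1 w f n d x \<ge> l n x"
    and l1_finite: "(\<integral>\<^sup>+x. l 1 x \<partial>obs \<mu> 1) < \<infinity>"
    and trunc: "truncatable P X \<pi>\<^sub>2 \<mu> F l"
    and \<psi>_rule: "stopping_rule \<mu> \<psi>"
    and \<psi>_form: "optimal_form \<mu> F l \<psi>"
    and \<psi>'_rule: "stopping_rule \<mu> \<psi>'"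
    and \<delta>_rule: "decision_rule \<mu> D \<delta>"
    and W_le: "\<And>i. i \<in> {1..k} \<Longrightarrow>
      Wloss P X \<pi>\<^sub>1 w (Ths i) \<psi>' \<delta> \<le> Wloss P X \<pi>\<^sub>1 w (Ths i) \<psi> \<delta>B"
  shows "ASN P X U \<pi>\<^sub>2 \<psi> \<le> ASN P X U \<pi>\<^sub>2 \<psi>'
    \<and> ((\<exists>i\<in>{1..k}. Wloss P X \<pi>\<^sub>1 w (Ths i) \<psi>' \<delta> < Wloss P X \<pi>\<^sub>1 w (Ths i) \<psi> \<delta>B)
         \<longrightarrow> ASN P X U \<pi>\<^sub>2 \<psi> < ASN P X U \<pi>\<^sub>2 \<psi>')
    \<and> ((\<forall>i\<in>{1..k}. Wloss P X \<pi>\<^sub>1 w (Ths i) \<psi>' \<delta> = Wloss P X \<pi>\<^sub>1 w (Ths i) \<psi> \<delta>B)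
         \<and> ASN P X U \<pi>\<^sub>2 \<psi> = ASN P X U \<pi>\<^sub>2 \<psi>'
         \<longrightarrow> optimal_form \<mu> F l \<psi>'
           \<and> (\<forall>n\<ge>1. AE x\<in>Sset \<mu> \<psi>' n in obs \<mu> n.
                 wloss k lam Ths \<pi>\<^sub>1 w f n (\<delta> n x) x = wloss k lam Ths \<pi>\<^sub>1 w f n (\<delta>B n x) x))"
proof -
  interpret model: sequential_model Th \<mu> P X U f
    by (rule model)
  have F: "F = mix_density \<pi>\<^sub>2 f"
    by (simp add: fun_eq_iff F_eq)
  have l: "l n = (\<lambda>x. wloss k lam Ths \<pi>\<^sub>1 w f n (\<delta>B n x) x)" for n
    by (simp add: fun_eq_iff l_eq)
  have wloss_m: "(\<lambda>x. wloss k lam Ths \<pi>\<^sub>1 w f n (\<delta> n x) x) \<in> borel_measurable (obs \<mu> n)"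
    if "1 \<le> n" "decision_rule \<mu> D \<delta>" for n \<delta>
    using that by (intro model.wloss_measurable[OF w_measurable \<pi>\<^sub>1 Ths_sets])
  have problem: "stopping_problem \<mu> (mix_density \<pi>\<^sub>2 f) l"
    unfolding stopping_problem_def stopping_problem_axioms_def
    using model.sigma_finite model.mix_density_measurable[OF \<pi>\<^sub>2] wloss_m[OF _ \<delta>B_rule]
      model.mix_density_consistent[OF \<pi>\<^sub>2] model.mix_density_total[OF \<pi>\<^sub>2] l1_finite
    by (auto simp: l)
  interpret stopping_problem \<mu> F l
    unfolding F by (rule problem)
  define C where "C = 1 + (\<integral>\<^sup>+x. VL 1 x \<partial>obs \<mu> 1)"
  define s where "s n x = ennreal (spsi \<psi>' n x)" for n x
  define wl where "wl n x = wloss k lam Ths \<pi>\<^sub>1 w f n (\<delta> n x) x" for n x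
  \<comment> \<open>Plain letters belong to \<open>(\<psi>, \<delta>B)\<close> and primed ones to
    \<open>(\<psi>', \<delta>)\<close>: \<open>a\<close> is the sample number, \<open>b\<close> the
    weighted loss. The mixed quantity \<open>c'\<close> is the weighted loss of \<psi>' with the
    Bayes decisions. The comparison runs
    \<open>a + b \<le> C \<le> a' + c' \<le> a' + b' \<le> a' + b\<close>.\<close>
  define a a' where "a = ASN P X U \<pi>\<^sub>2 \<psi>" and "a' = ASN P X U \<pi>\<^sub>2 \<psi>'"
  define b b' where "b = (\<Sum>i=1..k. ennreal (lam i) * Wloss P X \<pi>\<^sub>1 w (Ths i) \<psi> \<delta>B)"
    and "b' = (\<Sum>i=1..k. ennreal (lam i) * Wloss P X \<pi>\<^sub>1 w (Ths i) \<psi>' \<delta>)"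
  define c' where "c' = (\<Sum>n. \<integral>\<^sup>+x. s (Suc n) x * l (Suc n) x \<partial>obs \<mu> (Suc n))"
  have [measurable]: "wl (Suc n) \<in> borel_measurable (obs \<mu> (Suc n))" "l (Suc n) \<in> borel_measurable (obs \<mu> (Suc n))"
    "s (Suc n) \<in> borel_measurable (obs \<mu> (Suc n))" for n
    using wloss_m[of "Suc n", OF _ \<delta>_rule] l_measurable[of "Suc n"] spsi_measurable[OF \<psi>'_rule, of "Suc n"]
    by (auto simp: wl_def[abs_def] s_def[abs_def])
  note sum_Wloss = model.sum_Wloss_eq[OF w_measurable w_nonneg \<pi>\<^sub>1 Ths_sets]
  have b'_eq: "b' = (\<Sum>n. \<integral>\<^sup>+x. s (Suc n) x * wl (Suc n) x \<partial>obs \<mu> (Suc n))"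
    unfolding b'_def s_def wl_def by (rule sum_Wloss[OF _ _ _ \<psi>'_rule \<delta>_rule])
  have "b = (\<Sum>n. \<integral>\<^sup>+x. ennreal (spsi \<psi> (Suc n) x) * l (Suc n) x \<partial>obs \<mu> (Suc n))"
    unfolding b_def l by (rule sum_Wloss[OF _ _ _ \<psi>_rule \<delta>B_rule])
  then have ab: "stopping_risk \<psi> = a + b"
    using model.stopping_risk_eq_ASN_plus_loss[OF problem \<psi>_rule \<pi>\<^sub>2] by (simp add: a_def F)
  have ac: "stopping_risk \<psi>' = a' + c'"
    using model.stopping_risk_eq_ASN_plus_loss[OF problem \<psi>'_rule \<pi>\<^sub>2] by (simp add: a'_def c'_def s_def F)
  have lim: "(\<lambda>N. trunc_risk \<mu> F l N \<psi>') \<longlonglongrightarrow> stopping_risk \<psi>'"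
  proof -
    have "risk P X \<pi>\<^sub>2 \<mu> F l \<psi>' = stopping_risk \<psi>'"
      by (simp add: risk_def stopping_risk_def model.prob_stop_eq[OF \<psi>'_rule \<pi>\<^sub>2] F_eq)
    with trunc \<psi>'_rule show ?thesis
      by (auto simp: truncatable_def)
  qed
  have ab_le: "a + b \<le> C"
    using stopping_risk_le[OF \<psi>_rule \<psi>_form] by (simp add: ab C_def)
  have C_le: "C \<le> a' + c'"
    using stopping_risk_ge[OF \<psi>'_rule lim] by (simp add: ac C_def)
  \<comment> \<open>Finiteness of \<open>a\<close> and \<open>b\<close> comes from that of
    \<open>C\<close>; the cancellations below rest on it.\<close>
  have "a + b < \<infinity>"
    using ab_le initial_VL_finite unfolding C_def by (rule order_le_less_trans)
  then have fin: "a < \<infinity>" "b < \<infinity>"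
    by auto
  \<comment> \<open>The null set in the Bayes property does not depend on d, so d may be replaced by
    the data-dependent decision \<open>\<delta> (Suc n) x\<close>.\<close>
  have l_le: "AE x in obs \<mu> (Suc n). s (Suc n) x * l (Suc n) x \<le> s (Suc n) x * wl (Suc n) x" for n
    using \<delta>B_bayes[of "Suc n", simplified] AE_space
  proof eventually_elim
    case (elim x)
    then have "\<delta> (Suc n) x \<in> space D"
      using \<delta>_rule measurable_space[of "\<delta> (Suc n)" "obs \<mu> (Suc n)" D x] by (simp add: decision_rule_def)
    with elim show ?case
      by (auto simp: wl_def intro: mult_left_mono)
  qed
  have term_le: "(\<integral>\<^sup>+x. s (Suc n) x * l (Suc n) x \<partial>obs \<mu> (Suc n))
    \<le> (\<integral>\<^sup>+x. s (Suc n) x * wl (Suc n) x \<partial>obs \<mu> (Suc n))" for n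
    by (intro nn_integral_mono_AE l_le)
  have "c' \<le> b'"
    unfolding c'_def b'_eq by (intro suminf_le term_le summableI)
  have "b' \<le> b"
    unfolding b_def b'_def by (intro sum_mono mult_left_mono W_le) auto
  have key: "a + b \<le> a' + b'"
    using ab_le C_le \<open>c' \<le> b'\<close> by (meson add_left_mono order_trans)
  have "a \<le> a'"
    using order_trans[OF key add_left_mono[OF \<open>b' \<le> b\<close>]] fin(2)
    by (auto simp: add.commute[of _ b])
  moreover have "a < a'"
    if "\<exists>i\<in>{1..k}. Wloss P X \<pi>\<^sub>1 w (Ths i) \<psi>' \<delta> < Wloss P X \<pi>\<^sub>1 w (Ths i) \<psi> \<delta>B"
  proof -
    from that obtain j where j: "j \<in> {1..k}"
      and less: "Wloss P X \<pi>\<^sub>1 w (Ths j) \<psi>' \<delta> < Wloss P X \<pi>\<^sub>1 w (Ths j) \<psi> \<delta>B"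
      by auto
    have "b' < b"
      unfolding b_def b'_def
    proof (rule sum_strict_mono_ennreal[OF _ _ j])
      show "ennreal (lam j) * Wloss P X \<pi>\<^sub>1 w (Ths j) \<psi>' \<delta> < ennreal (lam j) * Wloss P X \<pi>\<^sub>1 w (Ths j) \<psi> \<delta>B"
        using less lam_pos[OF j] by (intro ennreal_mult_strict_left_mono) auto
      show "(\<Sum>i=1..k. ennreal (lam i) * Wloss P X \<pi>\<^sub>1 w (Ths i) \<psi> \<delta>B) < \<infinity>"
        using fin(2) by (simp add: b_def)
    qed (use W_le in \<open>auto intro!: mult_left_mono\<close>)
    \<comment> \<open>If the sample numbers were equal, \<open>a\<close> could be cancelled in
      \<open>key\<close>, against \<open>b' < b\<close>.\<close>
    show "a < a'"
    proof (rule ccontr)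
      assume "\<not> a < a'"
      with \<open>a \<le> a'\<close> have "a = a'"
        by simp
      with key fin(1) have "b \<le> b'"
        by auto
      with \<open>b' < b\<close> show False
        by simp
    qed
  qed
  moreover have "optimal_form \<mu> F l \<psi>' \<and> (\<forall>n\<ge>1. AE x\<in>Sset \<mu> \<psi>' n in obs \<mu> n. wl n x = l n x)"
    if W_eq: "\<forall>i\<in>{1..k}. Wloss P X \<pi>\<^sub>1 w (Ths i) \<psi>' \<delta> = Wloss P X \<pi>\<^sub>1 w (Ths i) \<psi> \<delta>B" and "a = a'"
  proof -
    have "b' = b"
      unfolding b_def b'_def using W_eq by (intro sum.cong) auto
    \<comment> \<open>Equality collapses the whole chain: \<psi>' has minimal risk and hence the
      optimal form, and its losses under \<delta> and under the Bayes decisions coincide.\<close>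
    have "a' + c' \<le> a' + b'"
      using \<open>c' \<le> b'\<close> by (rule add_left_mono)
    also have "\<dots> \<le> C"
      using ab_le \<open>a = a'\<close> \<open>b' = b\<close> by simp
    finally have "optimal_form \<mu> F l \<psi>'"
      using optimal_form_if_stopping_risk_minimal[OF \<psi>'_rule lim] by (simp add: ac C_def)
    have "a' + b' \<le> a' + c'"
      using ab_le C_le unfolding \<open>a = a'\<close> \<open>b' = b\<close> by (rule order_trans)
    then have "b' \<le> c'"
      using fin(1)[unfolded \<open>a = a'\<close>] by auto
    with \<open>c' \<le> b'\<close> have "c' = b'"
      by (rule antisym)
    have "b' < \<infinity>"
      using fin(2) unfolding \<open>b' = b\<close> .
    \<comment> \<open>The equality \<open>c' = b'\<close> descends first to the terms of the two
      series and then to almost every x, since terms and integrands are ordered and the totals are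
      finite.\<close>
    have terms_eq: "(\<integral>\<^sup>+x. s (Suc n) x * l (Suc n) x \<partial>obs \<mu> (Suc n))
      = (\<integral>\<^sup>+x. s (Suc n) x * wl (Suc n) x \<partial>obs \<mu> (Suc n))" for n
      by (rule suminf_ennreal_eq_imp_eq[OF term_le \<open>c' = b'\<close>[unfolded c'_def b'_eq] \<open>b' < \<infinity>\<close>[unfolded b'_eq]])
    have terms_finite: "(\<integral>\<^sup>+x. s (Suc n) x * wl (Suc n) x \<partial>obs \<mu> (Suc n)) < \<infinity>" for n
    proof (rule order_le_less_trans[OF _ \<open>b' < \<infinity>\<close>])
      show "(\<integral>\<^sup>+x. s (Suc n) x * wl (Suc n) x \<partial>obs \<mu> (Suc n)) \<le> b'"
        unfolding b'_eq using sum_le_suminf[OF summableI, of "{n}"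
            "\<lambda>n. \<integral>\<^sup>+x. s (Suc n) x * wl (Suc n) x \<partial>obs \<mu> (Suc n)"] by simp
    qed
    have eq: "AE x in obs \<mu> (Suc n). s (Suc n) x * l (Suc n) x = s (Suc n) x * wl (Suc n) x" for n
      by (rule nn_integral_eq_imp_AE_eq[OF _ _ l_le terms_eq terms_finite]) simp_all
    have "AE x\<in>Sset \<mu> \<psi>' n in obs \<mu> n. wl n x = l n x" if "1 \<le> n" for n
    proof -
      obtain m where n: "n = Suc m"
        using \<open>1 \<le> n\<close> by (cases n) auto
      show ?thesis
        \<comment> \<open>On \<open>Sset\<close> the factor \<open>s\<close> is positive and finite,
          so it cancels.\<close>
        using eq[of m] unfolding n[symmetric]
        by eventually_elim (auto simp: Sset_def s_def ennreal_mult_cancel_left ennreal_eq_0_iff)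
    qed
    with \<open>optimal_form \<mu> F l \<psi>'\<close> show ?thesis
      by blast
  qed
  ultimately show ?thesis
    unfolding a_def a'_def wl_def l_eq by blast
qed

end
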